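(* Let $1\le p_0<\infty$ and let $T$ be an operator such that $$T:L^{p_0}(u)\longrightarrow L^{p_0,\infty}(u)$$ is bounded for every $u\in A_{p_0}$, with norm at most $\varphi(\|u\|_{A_{p_0}})$ for some locally bounded function $\varphi$. Let $w$ be a weight on $(0,\infty)$ and $W(t)=\int_0^tw(s)\,ds$. If either (a) $1<p<\infty$, $w\in B_p$, $W(\infty)=\infty$ and, for some $0<\mu<1$ and some constant $C$, $$\bigg(\int_s^\infty\Big(\frac{t^{1-\mu}}{W(t)}\Big)^{p'}w(t)\,dt\bigg)^{1/p'}\le C\,\frac{s^{1-\mu}}{W^{1/p}(s)}\quad\text{for all }s>0;$$ or (b) $0<p\le1$ and $w$ satisfies that, for some $0<\delta<1$, $W^{1/p}(t)/t^\delta$ is quasi-decreasing and, for some $0<\mu<1$, $W^{1/p}(t)/t^{1-\mu}$ is quasi-increasing, then $$T:\Lambda^p(w)\longrightarrow\Lambda^{p,\infty}(w)$$ is bounded.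
   Context: $T$ acts on functions on $\mathbb R^n$ and is not assumed linear. $\|g\|_{L^{p,\infty}(u)}=\sup_{y>0}y\,u(\{|g|>y\})^{1/p}$. $A_p$ is the Muckenhoupt class on $\mathbb R^n$ with $\|u\|_{A_p}=\sup_Q\big(\frac1{|Q|}\int_Qu\big)\big(\frac1{|Q|}\int_Qu^{-1/(p-1)}\big)^{p-1}$ for $1<p<\infty$ and $\|u\|_{A_1}=\sup_Q\big(\frac1{|Q|}\int_Qu\big)\|u^{-1}\|_{L^\infty(Q)}$. A function $\varphi$ on $(0,\infty)$ is locally bounded if $\sup_{0<t<K}\varphi(t)<\infty$ for every $K>0$. With $f^*$ the decreasing rearrangement of $f$ with respect to Lebesgue measure on $\mathbb R^n$, the weighted Lorentz spaces are given by $\|f\|_{\Lambda^p(w)}=\big(\int_0^\infty f^*(t)^pw(t)\,dt\big)^{1/p}$ and $\|f\|_{\Lambda^{p,\infty}(w)}=\sup_{t>0}f^*(t)W^{1/p}(t)$. $w\in B_p$ means that there is $C$ with $r^p\int_r^\infty\frac{w(t)}{t^p}\,dt\le C\int_0^rw(t)\,dt$ for all $r>0$. A positive function $h$ on $(0,\infty)$ is quasi-decreasing (quasi-increasing) if there is $C$ with $h(t)\le Ch(s)$ (respectively $h(s)\le Ch(t)$) whenever $0<s<t$. $p'$ is the conjugate exponent of $p$. *)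

theory Defs
  imports "HOL-Probability.Essential_Supremum"
begin

text \<open>Real powers of extended nonnegative numbers; only used with exponent \<open>a > 0\<close>, so that
  \<open>\<infinity>\<close> is sent to \<open>\<infinity>\<close> and \<open>0\<close> to \<open>0\<close>.\<close>

definition epowr :: "ennreal \<Rightarrow> real \<Rightarrow> ennreal" (infixr "epowr" 80) where
  "x epowr a = (if x = \<infinity> then \<infinity> else ennreal (enn2real x powr a))"


section \<open>Muckenhoupt weights\<close>

definition cubes :: "'a::euclidean_space set set" where
  "cubes = {cbox a (a + h *\<^sub>R One) | a h. h > 0}"

text \<open>Weights are locally integrable and positive almost everywhere.  A nonnegative \<open>u\<close> that is
  not a.e. zero and has finite \<open>A\<^sub>p\<close> constant is automatically positive a.e.; requiring
  this discards only \<open>u = 0\<close>, and makes the value \<open>0 powr a = 0\<close> irrelevant below.\<close>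

definition weight :: "('a::euclidean_space \<Rightarrow> real) \<Rightarrow> bool" where
  "weight u \<longleftrightarrow> (AE x in lebesgue. u x > 0) \<and> (\<forall>Q\<in>cubes. set_integrable lebesgue Q u)"

definition avg :: "'a::euclidean_space set \<Rightarrow> ('a \<Rightarrow> real) \<Rightarrow> ennreal" where
  "avg Q u = (\<integral>\<^sup>+x\<in>Q. ennreal (u x) \<partial>lebesgue) / emeasure lebesgue Q"

definition Ap_const :: "real \<Rightarrow> ('a::euclidean_space \<Rightarrow> real) \<Rightarrow> ennreal" where
  "Ap_const p u =
    (if p = 1
     then SUP Q\<in>cubes. avg Q u * esssup (lebesgue_on Q) (\<lambda>x. inverse (ennreal (u x)))
     else SUP Q\<in>cubes. avg Q u * avg Q (\<lambda>x. u x powr (- 1 / (p - 1))) epowr (p - 1))"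

definition Ap :: "real \<Rightarrow> ('a::euclidean_space \<Rightarrow> real) set" where
  "Ap p = {u. weight u \<and> Ap_const p u < \<infinity>}"

definition locally_bounded :: "(real \<Rightarrow> real) \<Rightarrow> bool" where
  "locally_bounded \<phi> \<longleftrightarrow> (\<forall>K>0. bdd_above (\<phi> ` {0<..<K}))"


section \<open>Weighted Lebesgue and Lorentz spaces\<close>

text \<open>Functions on the Euclidean space take values in \<open>'k::real_normed_field\<close>, which covers
  both real and complex scalars.\<close>

definition Lp_norm ::
  "real \<Rightarrow> ('a::euclidean_space \<Rightarrow> real) \<Rightarrow> ('a \<Rightarrow> 'k::real_normed_field) \<Rightarrow> ennreal" where
  "Lp_norm p u f = (\<integral>\<^sup>+x. ennreal (norm (f x) powr p) * ennreal (u x) \<partial>lebesgue) epowr (1 / p)"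

definition weak_Lp_norm ::
  "real \<Rightarrow> ('a::euclidean_space \<Rightarrow> real) \<Rightarrow> ('a \<Rightarrow> 'k::real_normed_field) \<Rightarrow> ennreal" where
  "weak_Lp_norm p u g =
    (SUP y\<in>{0<..}. ennreal y *
      (\<integral>\<^sup>+x\<in>{x. norm (g x) > y}. ennreal (u x) \<partial>lebesgue) epowr (1 / p))"

text \<open>The decreasing rearrangement; it is \<open>\<infinity>\<close> where the set of admissible levels is empty.\<close>

definition rearr :: "('a::euclidean_space \<Rightarrow> 'k::real_normed_field) \<Rightarrow> real \<Rightarrow> ennreal" where
  "rearr f t =
    Inf {ennreal y | y. y \<ge> 0 \<and> emeasure lebesgue {x. norm (f x) > y} \<le> ennreal t}"

text \<open>Weights on \<open>(0,\<infinity>)\<close> are nonnegative with \<open>W(t) < \<infinity>\<close> for every \<open>t\<close>.  Values of \<open>w\<close> outside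
  \<open>(0,\<infinity>)\<close> are never used.\<close>

definition half_line_weight :: "(real \<Rightarrow> real) \<Rightarrow> bool" where
  "half_line_weight w \<longleftrightarrow>
    (\<forall>t>0. w t \<ge> 0) \<and> (\<forall>t>0. set_integrable lebesgue {0<..<t} w)"

definition prim :: "(real \<Rightarrow> real) \<Rightarrow> real \<Rightarrow> real" where
  "prim w t = (LINT s:{0<..<t}|lebesgue. w s)"

definition Lorentz_norm ::
  "real \<Rightarrow> (real \<Rightarrow> real) \<Rightarrow> ('a::euclidean_space \<Rightarrow> 'k::real_normed_field) \<Rightarrow> ennreal" where
  "Lorentz_norm p w f =
    (\<integral>\<^sup>+t\<in>{0<..}. (rearr f t epowr p * ennreal (w t)) \<partial>lebesgue) epowr (1 / p)"

definition weak_Lorentz_norm ::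
  "real \<Rightarrow> (real \<Rightarrow> real) \<Rightarrow> ('a::euclidean_space \<Rightarrow> 'k::real_normed_field) \<Rightarrow> ennreal" where
  "weak_Lorentz_norm p w f = (SUP t\<in>{0<..}. rearr f t * ennreal (prim w t powr (1 / p)))"

text \<open>\<open>T\<close> is bounded, with norm at most \<open>C\<close>, from the space of measurable functions with finite
  \<open>N\<close> to the space of measurable functions with finite \<open>N'\<close>.  Nothing is assumed about the
  values of \<open>T\<close> outside the first space.\<close>

definition bounded_op ::
  "(('a::euclidean_space \<Rightarrow> 'k::real_normed_field) \<Rightarrow> ('a \<Rightarrow> 'k)) \<Rightarrow>
   (('a \<Rightarrow> 'k) \<Rightarrow> ennreal) \<Rightarrow> (('a \<Rightarrow> 'k) \<Rightarrow> ennreal) \<Rightarrow> real \<Rightarrow> bool" where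
  "bounded_op T N N' C \<longleftrightarrow>
    (\<forall>f \<in> borel_measurable lebesgue. N f < \<infinity> \<longrightarrow>
      T f \<in> borel_measurable lebesgue \<and> N' (T f) \<le> ennreal C * N f)"


section \<open>Conditions on weights on the half-line\<close>

definition Bp :: "real \<Rightarrow> (real \<Rightarrow> real) set" where
  "Bp p = {w. \<exists>C::real. \<forall>r>0.
    ennreal (r powr p) * (\<integral>\<^sup>+t\<in>{r<..}. ennreal (w t / t powr p) \<partial>lebesgue)
      \<le> ennreal (C * prim w r)}"

definition quasi_decreasing :: "(real \<Rightarrow> real) \<Rightarrow> bool" where
  "quasi_decreasing h \<longleftrightarrow>
    (\<forall>t>0. h t > 0) \<and> (\<exists>C. \<forall>s t. 0 < s \<and> s < t \<longrightarrow> h t \<le> C * h s)"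

definition quasi_increasing :: "(real \<Rightarrow> real) \<Rightarrow> bool" where
  "quasi_increasing h \<longleftrightarrow>
    (\<forall>t>0. h t > 0) \<and> (\<exists>C. \<forall>s t. 0 < s \<and> s < t \<longrightarrow> h s \<le> C * h t)"

definition conj_exp :: "real \<Rightarrow> real" where
  "conj_exp p = p / (p - 1)"

definition cond_a :: "real \<Rightarrow> (real \<Rightarrow> real) \<Rightarrow> bool" where
  "cond_a p w \<longleftrightarrow> 1 < p \<and> w \<in> Bp p \<and> (\<integral>\<^sup>+t\<in>{0<..}. ennreal (w t) \<partial>lebesgue) = \<infinity> \<and>
    (\<exists>\<mu> C. 0 < \<mu> \<and> \<mu> < 1 \<and>
      (\<forall>s>0. (\<integral>\<^sup>+t\<in>{s<..}. ennreal ((t powr (1 - \<mu>) / prim w t) powr conj_exp p * w t)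
                \<partial>lebesgue) epowr (1 / conj_exp p)
             \<le> ennreal (C * (s powr (1 - \<mu>) / prim w s powr (1 / p)))))"

definition cond_b :: "real \<Rightarrow> (real \<Rightarrow> real) \<Rightarrow> bool" where
  "cond_b p w \<longleftrightarrow> 0 < p \<and> p \<le> 1 \<and>
    (\<exists>\<delta>. 0 < \<delta> \<and> \<delta> < 1 \<and> quasi_decreasing (\<lambda>t. prim w t powr (1 / p) / t powr \<delta>)) \<and>
    (\<exists>\<mu>. 0 < \<mu> \<and> \<mu> < 1 \<and> quasi_increasing (\<lambda>t. prim w t powr (1 / p) / t powr (1 - \<mu>)))"

end

(* In both cases (a) and (b) the function h = W^(1/p) has the property that h(t) / t^delta is
   quasi-decreasing and h(t) / t^(1-mu) is quasi-increasing for some delta, mu in (0,1): in case (a)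
   the first is the self-improvement of B_p, and the second follows by bounding the integral in the
   hypothesis from below over [x,y), where x > s and W(y) is comparable to 2 W(x). Since f^* h is at
   most the norm N of f in Lambda^p(w), these bounds control f^* at every point s by a power of t/s
   times B = A N / h(t).

   Fix t and let F be a subset of {|Tf| > K B} with t <= |F| < infinity. With M the maximal operator,
   put u0 = (M chi_F)^theta and u1 = (M (max 1 (|f|/B)^q))^(1/q), where q > 1 and theta < 1 is close
   to 1. By Coifman-Rochberg both are A_1 weights with constants independent of f and F, so
   u = u0 u1^(1-p0) is in A_p0 with uniformly bounded constant. Since u1 >= |f|/B, the integral of
   |f/B|^p0 u is at most that of |f/B| u0, which is bounded by a multiple of |F|; and u is bounded
   below on at least half of F. The weak type inequality for u therefore fails if K is large, so that
   |{|Tf| > K B}| <= t, that is (Tf)^*(t) h(t) <= K A N. *)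
theory Submission
  imports Defs
begin

text \<open>The operator is not assumed linear, so f cannot be cut at height B and its pieces sent
  through T separately: one weight has to serve the large and the small values of f at once. Where
  |f| > B, the bound u0 <= 1 suffices, because the distribution function of |f|/B decays like l^-a
  with a = 1/delta > 1. Where |f| <= B, it is only bounded by t l^-b with b = 1/(1-mu) > 1, so |f|/B
  need not be integrable there. Young's inequality with exponents b+1 and (b+1)/b then separates
  |f/B| u0 into |f/B|^(b+1) and (M chi_F)^(theta (b+1)/b), and theta has to exceed b/(b+1) because M
  chi_F is only controlled in weak L^1. The maximum with 1 in u1 keeps u <= 1. Moreover M(max 1
  (|f|/B)^q) is at most 1 plus the maximal function of (|f|/B)^q restricted to {|f| > B}, which is
  integrable for q < a; the lower bound of u on half of F is thus a weak type estimate.\<close>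

section \<open>Dyadic estimates of integrals by distribution functions\<close>

text \<open>A layer-cake estimate with discrete levels: each point where \<open>G\<close> is
  positive lies in a superlevel set of \<open>F\<close> whose constant \<open>c k\<close> bounds
  \<open>G\<close> there, so \<open>G\<close> is dominated by the sum of all steps. Overlaps only
  enlarge that sum, and the products \<open>c k * d k\<close> make it geometric.\<close>

lemma nn_integral_le_dyadic_sum:
  fixes F :: "'a \<Rightarrow> real" and G :: "'a \<Rightarrow> ennreal" and c :: "nat \<Rightarrow> real" and l :: "nat \<Rightarrow> real"
  assumes F[measurable]: "F \<in> borel_measurable M"
    and c: "\<And>k. 0 \<le> c k" and A: "0 \<le> A" and q: "0 \<le> q" "q < 1"
    and G: "\<And>x. x \<in> space M \<Longrightarrow> 0 < G x \<Longrightarrow> \<exists>k. l k < F x \<and> G x \<le> ennreal (c k)"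
    and tail: "\<And>k. emeasure M {x \<in> space M. l k < F x} \<le> ennreal (d k)"
    and d: "\<And>k. 0 \<le> d k" and cd: "\<And>k. c k * d k \<le> A * q ^ k"
  shows "(\<integral>\<^sup>+x. G x \<partial>M) \<le> ennreal (A / (1 - q))"
proof -
  have "(\<integral>\<^sup>+x. G x \<partial>M) \<le> (\<integral>\<^sup>+x. (\<Sum>k. ennreal (c k) * indicator {x \<in> space M. l k < F x} x) \<partial>M)"
  proof (rule nn_integral_mono)
    fix x assume x: "x \<in> space M"
    show "G x \<le> (\<Sum>k. ennreal (c k) * indicator {x \<in> space M. l k < F x} x)"
    proof (cases "G x = 0")
      case False
      then obtain k where k: "l k < F x" "G x \<le> ennreal (c k)"
        using G[OF x] by (auto simp: zero_less_iff_neq_zero)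
      have "G x \<le> (\<Sum>k\<in>{k}. ennreal (c k) * indicator {x \<in> space M. l k < F x} x)"
        using k x by simp
      also have "\<dots> \<le> (\<Sum>k. ennreal (c k) * indicator {x \<in> space M. l k < F x} x)"
        by (rule sum_le_suminf) auto
      finally show ?thesis .
    qed simp
  qed
  also have "\<dots> = (\<Sum>k. ennreal (c k) * emeasure M {x \<in> space M. l k < F x})"
    by (subst nn_integral_suminf) (auto simp: nn_integral_cmult_indicator)
  also have "\<dots> \<le> (\<Sum>k. ennreal (A * q ^ k))"
  proof (intro suminf_le summableI)
    fix k
    have "ennreal (c k) * emeasure M {x \<in> space M. l k < F x} \<le> ennreal (c k) * ennreal (d k)"
      by (intro mult_left_mono tail) simp
    also have "\<dots> \<le> ennreal (A * q ^ k)"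
      using c d cd by (simp add: ennreal_mult[symmetric] ennreal_leI)
    finally show "ennreal (c k) * emeasure M {x \<in> space M. l k < F x} \<le> ennreal (A * q ^ k)" .
  qed
  also have "\<dots> = ennreal (A / (1 - q))"
  proof (rule suminf_ennreal_eq)
    show "(\<lambda>k. A * q ^ k) sums (A / (1 - q))"
      using sums_mult[OF geometric_sums[of q], of A] q by simp
  qed (use A q in auto)
  finally show ?thesis .
qed

text \<open>The shell 2^k < F <= 2^(k+1) contributes at most A 2^r 2^((r-a)k), a convergent
  geometric series because r < a.\<close>

lemma nn_integral_upper_tail:
  fixes F :: "'a \<Rightarrow> real"
  assumes F: "F \<in> borel_measurable M" and r: "0 < r" "r < a" and A: "0 \<le> A"
    and tail: "\<And>l. 1 \<le> l \<Longrightarrow> emeasure M {x \<in> space M. l < F x} \<le> ennreal (A * l powr - a)"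
  shows "(\<integral>\<^sup>+x\<in>{x. 1 < F x}. ennreal (F x powr r) \<partial>M)
    \<le> ennreal (A * (2 powr r / (1 - 2 powr (r - a))))"
proof -
  have "(\<integral>\<^sup>+x\<in>{x. 1 < F x}. ennreal (F x powr r) \<partial>M)
      \<le> ennreal ((A * 2 powr r) / (1 - 2 powr (r - a)))"
  proof (rule nn_integral_le_dyadic_sum[OF F, where l = "\<lambda>k. 2 powr real k"
        and c = "\<lambda>k. 2 powr ((real k + 1) * r)" and d = "\<lambda>k. A * (2 powr real k) powr - a"])
    fix x assume "0 < ennreal (F x powr r) * indicator {x. 1 < F x} x"
    then have x: "1 < F x" by (auto split: split_indicator_asm)
    \<comment> \<open>The ceiling minus one instead of the floor: 2^k < F x must be strict even when
      F x is a power of 2.\<close>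
    define k where "k = nat (\<lceil>log 2 (F x)\<rceil> - 1)"
    have "0 < log 2 (F x)" using x by simp
    then have k: "real k < log 2 (F x)" "log 2 (F x) \<le> real k + 1"
      unfolding k_def by linarith+
    have "2 powr real k < 2 powr log 2 (F x)" "2 powr log 2 (F x) \<le> 2 powr (real k + 1)"
      using k by auto
    then have "2 powr real k < F x" "F x \<le> 2 powr (real k + 1)"
      using x by auto
    moreover from this have "F x powr r \<le> (2 powr (real k + 1)) powr r"
      using x r by (intro powr_mono2) auto
    ultimately show "\<exists>k. 2 powr real k < F x \<and>
        ennreal (F x powr r) * indicator {x. 1 < F x} x \<le> ennreal (2 powr ((real k + 1) * r))"
      using x by (intro exI[of _ k]) (auto simp: powr_powr ennreal_leI)
  next
    fix k :: nat
    show "emeasure M {x \<in> space M. 2 powr real k < F x} \<le> ennreal (A * (2 powr real k) powr - a)"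
      by (rule tail) (simp add: ge_one_powr_ge_zero)
    show "2 powr ((real k + 1) * r) * (A * (2 powr real k) powr - a) \<le> A * 2 powr r * (2 powr (r - a)) ^ k"
      by (simp add: powr_powr powr_power powr_add[symmetric] algebra_simps)
    show "2 powr (r - a) < (1::real)"
      using r powr_less_mono[of "r - a" 0 2] by simp
  qed (use A in auto)
  then show ?thesis by simp
qed

text \<open>The counterpart near 0: the series over the shells 2^(-k-1) < F <= 2^-k converges
  because b < r. Points with \<open>F x = 0\<close> contribute \<open>0 powr r = 0\<close>.\<close>

lemma nn_integral_lower_tail:
  fixes F :: "'a \<Rightarrow> real"
  assumes F: "F \<in> borel_measurable M" and r: "0 < b" "b < r" and A: "0 \<le> A"
    and tail: "\<And>l. 0 < l \<Longrightarrow> l \<le> 1 \<Longrightarrow> emeasure M {x \<in> space M. l < F x} \<le> ennreal (A * l powr - b)"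
  shows "(\<integral>\<^sup>+x\<in>{x. 0 \<le> F x \<and> F x \<le> 1}. ennreal (F x powr r) \<partial>M)
    \<le> ennreal (A * (2 powr b / (1 - 2 powr (b - r))))"
proof -
  have "(\<integral>\<^sup>+x\<in>{x. 0 \<le> F x \<and> F x \<le> 1}. ennreal (F x powr r) \<partial>M)
      \<le> ennreal ((A * 2 powr b) / (1 - 2 powr (b - r)))"
  proof (rule nn_integral_le_dyadic_sum[OF F, where l = "\<lambda>k. 2 powr (- real k - 1)"
        and c = "\<lambda>k. 2 powr (- real k * r)" and d = "\<lambda>k. A * (2 powr (- real k - 1)) powr - b"])
    fix x assume "0 < ennreal (F x powr r) * indicator {x. 0 \<le> F x \<and> F x \<le> 1} x"
    then have x: "0 < F x" "F x \<le> 1" by (auto split: split_indicator_asm)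
    define k where "k = nat (\<lfloor>- log 2 (F x)\<rfloor>)"
    have "log 2 (F x) \<le> 0" using x by simp
    then have k: "- real k - 1 < log 2 (F x)" "log 2 (F x) \<le> - real k"
      unfolding k_def by linarith+
    have "2 powr (- real k - 1) < 2 powr log 2 (F x)" "2 powr log 2 (F x) \<le> 2 powr (- real k)"
      using k by auto
    then have "2 powr (- real k - 1) < F x" "F x \<le> 2 powr (- real k)"
      using x by auto
    moreover from this have "F x powr r \<le> (2 powr (- real k)) powr r"
      using x r by (intro powr_mono2) auto
    ultimately show "\<exists>k. 2 powr (- real k - 1) < F x \<and>
        ennreal (F x powr r) * indicator {x. 0 \<le> F x \<and> F x \<le> 1} x \<le> ennreal (2 powr (- real k * r))"
      using x by (intro exI[of _ k]) (auto simp: powr_powr ennreal_leI)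
  next
    fix k :: nat
    have "2 powr (- real k - 1) \<le> 2 powr (0::real)" by (rule powr_mono) auto
    then show "emeasure M {x \<in> space M. 2 powr (- real k - 1) < F x} \<le> ennreal (A * (2 powr (- real k - 1)) powr - b)"
      by (intro tail) auto
    show "2 powr (- real k * r) * (A * (2 powr (- real k - 1)) powr - b) \<le> A * 2 powr b * (2 powr (b - r)) ^ k"
      by (simp add: powr_powr powr_power powr_add[symmetric] algebra_simps)
    show "2 powr (b - r) < (1::real)"
      using r powr_less_mono[of "b - r" 0 2] by simp
  qed (use A in auto)
  then show ?thesis by simp
qed

section \<open>The Hardy--Littlewood maximal operator\<close>

definition ball_mean :: "('a::euclidean_space \<Rightarrow> ennreal) \<Rightarrow> 'a \<Rightarrow> real \<Rightarrow> ennreal" where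
  "ball_mean g c r = (\<integral>\<^sup>+y\<in>ball c r. g y \<partial>lebesgue) / emeasure lebesgue (ball c r)"

text \<open>Including \<open>g\<close> itself in the supremum makes \<open>g \<le> hl_max g\<close> hold everywhere, so that the
  Lebesgue differentiation theorem is not needed.\<close>

definition hl_max :: "('a::euclidean_space \<Rightarrow> ennreal) \<Rightarrow> 'a \<Rightarrow> ennreal" where
  "hl_max g x = sup (g x) (SUP (c, r)\<in>{(c, r). x \<in> ball c r}. ball_mean g c r)"

lemma emeasure_lebesgue_ball:
  "0 \<le> r \<Longrightarrow> emeasure lebesgue (ball (c::'a::euclidean_space) r)
    = ennreal (unit_ball_vol (real DIM('a)) * r ^ DIM('a))"
  by (simp add: emeasure_ball)

lemma emeasure_ball_pos_finite:
  fixes c :: "'a::euclidean_space"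
  assumes "0 < r"
  shows "emeasure lebesgue (ball c r) \<noteq> 0" "emeasure lebesgue (ball c r) \<noteq> \<infinity>"
  using assms by (simp_all add: emeasure_ball ennreal_eq_0_iff not_le)

lemma emeasure_ball_scale:
  fixes c d :: "'a::euclidean_space"
  assumes "0 \<le> r" "0 \<le> k"
  shows "emeasure lebesgue (ball c (k * r)) = ennreal (k ^ DIM('a)) * emeasure lebesgue (ball d r)"
  using assms by (simp add: emeasure_ball ennreal_mult[symmetric] power_mult_distrib mult_ac)

lemma ball_mean_mult:
  assumes "0 < r"
  shows "ball_mean g c r * emeasure lebesgue (ball c r) = (\<integral>\<^sup>+y\<in>ball c r. g y \<partial>lebesgue)"
  using emeasure_ball_pos_finite[OF assms, of c]
  by (simp add: ball_mean_def ennreal_divide_times top.not_eq_extremum)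

lemma less_ball_mean_iff:
  assumes "0 < r"
  shows "l < ball_mean g c r \<longleftrightarrow> l * emeasure lebesgue (ball c r) < (\<integral>\<^sup>+y\<in>ball c r. g y \<partial>lebesgue)"
proof -
  have "ball_mean g c r \<le> l \<longleftrightarrow> (\<integral>\<^sup>+y\<in>ball c r. g y \<partial>lebesgue) \<le> l * emeasure lebesgue (ball c r)"
    using emeasure_ball_pos_finite[OF assms, of c] unfolding ball_mean_def
    by (metis ball_mean_def ball_mean_mult[OF assms] divide_le_posI_ennreal mult.commute mult_right_mono
        zero_le zero_less_iff_neq_zero)
  then show ?thesis by (simp add: not_le[symmetric])
qed

lemma less_hl_max_iff:
  "l < hl_max g x \<longleftrightarrow> l < g x \<or> (\<exists>c r. x \<in> ball c r \<and> l < ball_mean g c r)"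
  by (auto simp: hl_max_def sup_max less_max_iff_disj less_SUP_iff)

lemma le_hl_max: "g x \<le> hl_max g x"
  by (simp add: hl_max_def)

lemma ball_mean_le_hl_max: "x \<in> ball c r \<Longrightarrow> ball_mean g c r \<le> hl_max g x"
  unfolding hl_max_def by (rule le_supI2, rule SUP_upper2[of "(c, r)"]) auto

lemma hl_max_le:
  assumes "\<And>x. g x \<le> k"
  shows "hl_max g x \<le> k"
  unfolding hl_max_def
proof (safe intro!: sup_least SUP_least assms)
  fix c r assume "x \<in> ball c r"
  then have r: "0 < r" by (metis ball_eq_empty empty_iff not_le)
  have "(\<integral>\<^sup>+y\<in>ball c r. g y \<partial>lebesgue) \<le> (\<integral>\<^sup>+y\<in>ball c r. k \<partial>lebesgue)"
    by (intro nn_integral_mono mult_right_mono assms) auto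
  then have "\<not> k < ball_mean g c r"
    by (simp add: less_ball_mean_iff[OF r] nn_integral_cmult_indicator not_less)
  then show "ball_mean g c r \<le> k" by simp
qed

text \<open>A positive constant is not integrable; splitting it off leaves a function to which the
  weak type bound can be applied.\<close>

lemma hl_max_add_const_le:
  fixes g :: "'a::euclidean_space \<Rightarrow> ennreal"
  assumes g[measurable]: "g \<in> borel_measurable lebesgue"
  shows "hl_max (\<lambda>y. k + g y) x \<le> k + hl_max g x"
  unfolding hl_max_def[of "\<lambda>y. k + g y"]
proof (safe intro!: sup_least SUP_least add_left_mono le_hl_max)
  fix c :: 'a and r assume x: "x \<in> ball c r"
  have [measurable]: "ball c r \<in> sets lebesgue" by simp
  have r: "0 < r" using x by (metis ball_eq_empty empty_iff not_le)
  have "(\<integral>\<^sup>+y\<in>ball c r. (k + g y) \<partial>lebesgue) = k * emeasure lebesgue (ball c r) + (\<integral>\<^sup>+y\<in>ball c r. g y \<partial>lebesgue)"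
    unfolding distrib_right by (subst nn_integral_add) (auto simp: nn_integral_cmult_indicator)
  also have "\<dots> = (k + ball_mean g c r) * emeasure lebesgue (ball c r)"
    by (simp only: distrib_right ball_mean_mult[OF r])
  finally have "\<not> k + ball_mean g c r < ball_mean (\<lambda>y. k + g y) c r"
    by (simp add: less_ball_mean_iff[OF r])
  then show "ball_mean (\<lambda>y. k + g y) c r \<le> k + hl_max g x"
    using ball_mean_le_hl_max[OF x, of g] by (meson add_left_mono not_less order_trans)
qed

lemma hl_max_mono:
  assumes "\<And>y. g y \<le> h y"
  shows "hl_max g x \<le> hl_max h x"
  unfolding hl_max_def
  by (intro sup_mono SUP_subset_mono subset_refl assms)
     (auto simp: ball_mean_def intro!: divide_right_mono_ennreal nn_integral_mono mult_right_mono assms)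

lemma sets_lebesgue_greater:
  fixes g :: "'a::euclidean_space \<Rightarrow> 'b::{second_countable_topology, linorder_topology}"
  assumes "g \<in> borel_measurable lebesgue"
  shows "{x. l < g x} \<in> sets lebesgue"
  using measurable_sets[OF assms, of "{l<..}"] by (simp add: vimage_def)

text \<open>The maximal function is uncentred, so the superlevel set of the supremum is a union of
  open balls and hence open; no countable family of balls has to be selected.\<close>

lemma borel_measurable_hl_max[measurable]:
  fixes g :: "'a::euclidean_space \<Rightarrow> ennreal"
  assumes [measurable]: "g \<in> borel_measurable lebesgue"
  shows "hl_max g \<in> borel_measurable lebesgue"
proof (rule borel_measurableI_greater)
  fix l
  have "{x. l < hl_max g x} = {x. l < g x} \<union> (\<Union>(c, r)\<in>{(c, r). l < ball_mean g c r}. ball c r)"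
    by (auto simp: less_hl_max_iff)
  moreover have "open (\<Union>(c, r)\<in>{(c, r). l < ball_mean g c r}. ball c r)"
    by (rule open_UN) auto
  then have "(\<Union>(c, r)\<in>{(c, r). l < ball_mean g c r}. ball c r) \<in> sets lebesgue"
    by (simp add: borel_open sets_completionI_sets)
  moreover have "{x. l < g x} \<in> sets lebesgue"
    by (rule sets_lebesgue_greater) fact
  ultimately show "{x \<in> space lebesgue. l < hl_max g x} \<in> sets lebesgue"
    by (simp add: sets.Un)
qed

text \<open>Countable subadditivity over an arbitrary countable index set, so that the Vitali family
  need not be enumerated.\<close>

lemma emeasure_UN_le_nn_integral_count_space:
  assumes C: "countable C" and A[measurable]: "\<And>i. i \<in> C \<Longrightarrow> A i \<in> sets M"
  shows "emeasure M (\<Union>i\<in>C. A i) \<le> (\<integral>\<^sup>+i. emeasure M (A i) \<partial>count_space C)"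
proof -
  have "emeasure M (\<Union>i\<in>C. A i) = (\<integral>\<^sup>+x. indicator (\<Union>i\<in>C. A i) x \<partial>M)"
    using C by (subst nn_integral_indicator) (auto intro: sets.countable_UN')
  also have "\<dots> \<le> (\<integral>\<^sup>+x. (\<integral>\<^sup>+i. indicator (A i) x \<partial>count_space C) \<partial>M)"
  proof (rule nn_integral_mono)
    fix x
    show "indicator (\<Union>i\<in>C. A i) x \<le> (\<integral>\<^sup>+i. (indicator (A i) x :: ennreal) \<partial>count_space C)"
    proof (cases "x \<in> (\<Union>i\<in>C. A i)")
      case True
      then obtain i where i: "i \<in> C" "x \<in> A i" by auto
      then show ?thesis
        using nn_integral_ge_point[OF i(1), of "\<lambda>i. indicator (A i) x"] True by simp
    qed simp
  qed
  also have "\<dots> = (\<integral>\<^sup>+i. (\<integral>\<^sup>+x. indicator (A i) x \<partial>M) \<partial>count_space C)"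
    using C by (intro nn_integral_count_space_nn_integral) auto
  also have "\<dots> = (\<integral>\<^sup>+i. emeasure M (A i) \<partial>count_space C)"
    by (intro nn_integral_cong) simp
  finally show ?thesis .
qed

text \<open>Vitali's covering argument. The factor 5^n comes from the fivefold dilates, the summand
  1 from the pointwise term \<open>g x\<close> in \<open>hl_max\<close>, whose superlevel set is
  handled by Markov's inequality.\<close>

theorem hl_max_weak_type:
  fixes g :: "'a::euclidean_space \<Rightarrow> ennreal"
  assumes g[measurable]: "g \<in> borel_measurable lebesgue" and l: "0 < l"
  shows "ennreal l * emeasure lebesgue {x. ennreal l < hl_max g x}
    \<le> ennreal (5 ^ DIM('a) + 1) * (\<integral>\<^sup>+x. g x \<partial>lebesgue)"
proof (cases "(\<integral>\<^sup>+x. g x \<partial>lebesgue) = \<infinity>")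
  case True
  moreover have "ennreal (5 ^ DIM('a) + 1) \<noteq> 0"
    by (simp add: ennreal_eq_0_iff not_le add_pos_pos del: ennreal_plus)
  ultimately show ?thesis by (simp add: ennreal_mult_top del: ennreal_plus)
next
  case False
  then obtain G where G: "(\<integral>\<^sup>+x. g x \<partial>lebesgue) = ennreal G" "0 \<le> G"
    by (cases "\<integral>\<^sup>+x. g x \<partial>lebesgue") auto
  let ?v = "unit_ball_vol (real DIM('a))"
  have v: "0 < ?v" by simp
  define K :: "('a \<times> real) set" where "K = {(c, r). 0 < r \<and> ennreal l < ball_mean g c r}"
  \<comment> \<open>The covering lemma requires bounded radii. A ball in \<open>K\<close> has
    measure at most G / l, and r <= r^n for r > 1.\<close>
  define R where "R = max 1 (G / (l * ?v))"
  have le: "(\<integral>\<^sup>+x\<in>A. g x \<partial>lebesgue) \<le> (\<integral>\<^sup>+x. g x \<partial>lebesgue)" for A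
    by (intro nn_integral_mono) (auto split: split_indicator)
  have K: "ennreal l * emeasure lebesgue (ball (fst i) (snd i)) \<le> (\<integral>\<^sup>+x\<in>ball (fst i) (snd i). g x \<partial>lebesgue)" "0 < snd i"
    if "i \<in> K" for i
    using that by (auto simp: K_def less_ball_mean_iff less_imp_le)
  have bd: "0 < snd i \<and> snd i \<le> R" if i: "i \<in> K" for i
  proof
    show r: "0 < snd i" using K[OF i] by simp
    have "ennreal l * ennreal (?v * snd i ^ DIM('a)) \<le> ennreal G"
      using order_trans[OF K(1)[OF i] le] r by (simp add: G emeasure_ball less_imp_le)
    then have "l * (?v * snd i ^ DIM('a)) \<le> G"
      using l r v G by (simp add: ennreal_mult[symmetric])
    then have *: "snd i ^ DIM('a) \<le> G / (l * ?v)"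
      using l v by (simp add: field_simps)
    show "snd i \<le> R"
    proof (cases "snd i \<le> 1")
      case False
      then have "snd i ^ 1 \<le> snd i ^ DIM('a)"
        by (intro power_increasing) (auto simp: Suc_le_eq)
      then show ?thesis using * by (simp add: R_def)
    qed (simp add: R_def)
  qed
  obtain C where C: "countable C" "C \<subseteq> K"
    "pairwise (\<lambda>i j. disjnt (cball (fst i) (snd i)) (cball (fst j) (snd j))) C"
    and cov: "\<And>i. i \<in> K \<Longrightarrow> \<exists>j. j \<in> C \<and> \<not> disjnt (cball (fst i) (snd i)) (cball (fst j) (snd j)) \<and>
         cball (fst i) (snd i) \<subseteq> ball (fst j) (5 * snd j)"
    by (rule Vitali_covering_lemma_cballs_balls[of K snd R fst]) (use bd in auto)
  have disj: "disjoint_family_on (\<lambda>i. ball (fst i) (snd i)) C"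
    unfolding disjoint_family_on_def
  proof (intro ballI impI)
    fix i j assume "i \<in> C" "j \<in> C" "i \<noteq> j"
    then have "disjnt (cball (fst i) (snd i)) (cball (fst j) (snd j))"
      using C(3) by (auto simp: pairwise_def)
    then show "ball (fst i) (snd i) \<inter> ball (fst j) (snd j) = {}"
      by (meson ball_subset_cball disjnt_def disjnt_subset1 disjnt_subset2)
  qed
  have sub: "{x. ennreal l < hl_max g x} \<subseteq> {x. ennreal l < g x} \<union> (\<Union>j\<in>C. ball (fst j) (5 * snd j))"
  proof
    fix x assume "x \<in> {x. ennreal l < hl_max g x}"
    then consider "ennreal l < g x" | c r where "x \<in> ball c r" "ennreal l < ball_mean g c r"
      by (auto simp: less_hl_max_iff)
    then show "x \<in> {x. ennreal l < g x} \<union> (\<Union>j\<in>C. ball (fst j) (5 * snd j))"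
    proof cases
      case 2
      then have "0 < r" by (metis ball_eq_empty empty_iff not_le)
      then have "(c, r) \<in> K" using 2 by (simp add: K_def)
      from cov[OF this] obtain j where "j \<in> C" "cball c r \<subseteq> ball (fst j) (5 * snd j)" by auto
      then show ?thesis using 2(1) ball_subset_cball by blast
    qed simp
  qed
  have gl: "ennreal l * emeasure lebesgue {x. ennreal l < g x} \<le> (\<integral>\<^sup>+x. g x \<partial>lebesgue)"
  proof -
    have "ennreal l * emeasure lebesgue {x. ennreal l < g x} = (\<integral>\<^sup>+x. ennreal l * indicator {x. ennreal l < g x} x \<partial>lebesgue)"
      by (subst nn_integral_cmult_indicator) (auto intro: sets_lebesgue_greater g)
    also have "\<dots> \<le> (\<integral>\<^sup>+x. g x \<partial>lebesgue)"
      by (intro nn_integral_mono) (auto split: split_indicator)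
    finally show ?thesis .
  qed
  have meas[measurable]: "ball (c::'a) r \<in> sets lebesgue" for c r by simp
  have "emeasure lebesgue (\<Union>j\<in>C. ball (fst j) (5 * snd j))
      \<le> (\<integral>\<^sup>+j. emeasure lebesgue (ball (fst j) (5 * snd j)) \<partial>count_space C)"
    by (rule emeasure_UN_le_nn_integral_count_space) (use C in auto)
  then have "ennreal l * emeasure lebesgue (\<Union>j\<in>C. ball (fst j) (5 * snd j))
      \<le> ennreal l * (\<integral>\<^sup>+j. emeasure lebesgue (ball (fst j) (5 * snd j)) \<partial>count_space C)"
    by (rule mult_left_mono) simp
  also have "\<dots> = (\<integral>\<^sup>+j. ennreal l * emeasure lebesgue (ball (fst j) (5 * snd j)) \<partial>count_space C)"
    by (simp add: nn_integral_cmult)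
  also have "\<dots> \<le> (\<integral>\<^sup>+j. ennreal (5 ^ DIM('a)) * (\<integral>\<^sup>+x\<in>ball (fst j) (snd j). g x \<partial>lebesgue) \<partial>count_space C)"
  proof (rule nn_integral_mono)
    fix j assume "j \<in> space (count_space C)"
    then have j: "j \<in> K" using C by auto
    have "ennreal l * emeasure lebesgue (ball (fst j) (5 * snd j))
        = ennreal (5 ^ DIM('a)) * (ennreal l * emeasure lebesgue (ball (fst j) (snd j)))"
      using emeasure_ball_scale[of "snd j" 5 "fst j" "fst j"] K(2)[OF j] by (simp add: mult_ac)
    also have "\<dots> \<le> ennreal (5 ^ DIM('a)) * (\<integral>\<^sup>+x\<in>ball (fst j) (snd j). g x \<partial>lebesgue)"
      by (intro mult_left_mono K j) simp
    finally show "ennreal l * emeasure lebesgue (ball (fst j) (5 * snd j)) \<le> \<dots>" .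
  qed
  also have "\<dots> = ennreal (5 ^ DIM('a)) * (\<integral>\<^sup>+j. (\<integral>\<^sup>+x\<in>ball (fst j) (snd j). g x \<partial>lebesgue) \<partial>count_space C)"
    by (simp add: nn_integral_cmult)
  \<comment> \<open>As values of the measure with density \<open>g\<close>, the integrals over the
    disjoint balls add up to at most the whole integral.\<close>
  also have "(\<integral>\<^sup>+j. (\<integral>\<^sup>+x\<in>ball (fst j) (snd j). g x \<partial>lebesgue) \<partial>count_space C)
      = (\<integral>\<^sup>+j. emeasure (density lebesgue g) (ball (fst j) (snd j)) \<partial>count_space C)"
    by (intro nn_integral_cong) (simp add: emeasure_density)
  also have "\<dots> = emeasure (density lebesgue g) (\<Union>j\<in>C. ball (fst j) (snd j))"
    by (rule emeasure_UN_countable[symmetric]) (use C disj in auto)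
  also have "\<dots> \<le> emeasure (density lebesgue g) UNIV"
    by (rule emeasure_mono) auto
  also have "\<dots> = (\<integral>\<^sup>+x. g x \<partial>lebesgue)"
    by (subst emeasure_density) auto
  finally have U: "ennreal l * emeasure lebesgue (\<Union>j\<in>C. ball (fst j) (5 * snd j))
     \<le> ennreal (5 ^ DIM('a)) * (\<integral>\<^sup>+x. g x \<partial>lebesgue)" by (simp add: mult_left_mono)
  have Um: "(\<Union>j\<in>C. ball (fst j) (5 * snd j)) \<in> sets lebesgue"
    using C(1) by (intro sets.countable_UN') auto
  have "ennreal l * emeasure lebesgue {x. ennreal l < hl_max g x}
     \<le> ennreal l * (emeasure lebesgue {x. ennreal l < g x} + emeasure lebesgue (\<Union>j\<in>C. ball (fst j) (5 * snd j)))"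
    using Um by (intro mult_left_mono order_trans[OF emeasure_mono[OF sub] emeasure_subadditive])
      (auto intro: sets_lebesgue_greater g)
  also have "\<dots> \<le> (\<integral>\<^sup>+x. g x \<partial>lebesgue) + ennreal (5 ^ DIM('a)) * (\<integral>\<^sup>+x. g x \<partial>lebesgue)"
    unfolding distrib_left by (intro add_mono gl U)
  also have "\<dots> = ennreal (5 ^ DIM('a) + 1) * (\<integral>\<^sup>+x. g x \<partial>lebesgue)"
    by (simp add: distrib_right add.commute)
  finally show ?thesis .
qed

section \<open>Powers of maximal functions are A1 weights\<close>

text \<open>The pointwise form of the A_1 condition. The constant is a parameter because its
  independence of the function has to be tracked; the exceptional null set may depend on the
  cube.\<close>

definition a1_bound :: "real \<Rightarrow> ('a::euclidean_space \<Rightarrow> real) \<Rightarrow> bool" where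
  "a1_bound C v \<longleftrightarrow> (\<forall>Q\<in>cubes. AE x in lebesgue. x \<in> Q \<longrightarrow> avg Q v \<le> ennreal (C * v x))"

lemma dist_cube_less:
  fixes a x y :: "'a::euclidean_space"
  assumes "0 < h" and x: "x \<in> cbox a (a + h *\<^sub>R One)" and y: "y \<in> cbox a (a + h *\<^sub>R One)"
  shows "dist x y < 2 * real DIM('a) * h"
proof -
  have "dist x y \<le> (\<Sum>i\<in>Basis. \<bar>(x - y) \<bullet> i\<bar>)"
    unfolding dist_norm by (rule norm_le_l1)
  also have "\<dots> \<le> (\<Sum>i\<in>(Basis::'a set). h)"
  proof (rule sum_mono)
    fix i :: 'a assume i: "i \<in> Basis"
    have "a \<bullet> i \<le> x \<bullet> i" "x \<bullet> i \<le> a \<bullet> i + h" "a \<bullet> i \<le> y \<bullet> i" "y \<bullet> i \<le> a \<bullet> i + h"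
      using i x y by (auto simp: mem_box inner_add_left)
    then show "\<bar>(x - y) \<bullet> i\<bar> \<le> h" by (simp add: inner_diff_left)
  qed
  also have "\<dots> < 2 * real DIM('a) * h"
    using \<open>0 < h\<close> by simp
  finally show ?thesis .
qed

lemma emeasure_cube:
  fixes a :: "'a::euclidean_space"
  assumes "0 < h"
  shows "emeasure lborel (cbox a (a + h *\<^sub>R One)) = ennreal (h ^ DIM('a))"
  using assms by (subst emeasure_lborel_cbox) (auto simp: inner_add_left inner_diff_left)

lemma cubesE:
  fixes Q :: "'a::euclidean_space set"
  assumes "Q \<in> cubes"
  obtains a h where "0 < h" "Q = cbox a (a + h *\<^sub>R One)" "Q \<in> sets lebesgue"
    "emeasure lebesgue Q = ennreal (h ^ DIM('a))"
  using assms by (auto simp: cubes_def emeasure_cube)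

text \<open>A ball that meets the cube and has mean greater than \<open>5 ^ n * hl_max g x\<close> is small: otherwise its
  fivefold dilation would contain \<open>x\<close>. It therefore lies in the ball of radius \<open>4 n h\<close> around \<open>a\<close>, and
  the weak type estimate may be applied to the restriction of \<open>g\<close> to that ball.\<close>

lemma hl_max_localized:
  fixes g :: "'a::euclidean_space \<Rightarrow> ennreal"
  assumes g[measurable]: "g \<in> borel_measurable lebesgue" and h: "0 < h"
    and x: "x \<in> cbox a (a + h *\<^sub>R One)" and m: "hl_max g x \<le> ennreal m" "0 < m"
    and l: "5 ^ DIM('a) * m \<le> l"
  shows "ennreal l * emeasure lebesgue {y \<in> cbox a (a + h *\<^sub>R One). ennreal l < hl_max g y}
    \<le> ennreal ((5 ^ DIM('a) + 1) * m * (unit_ball_vol (real DIM('a)) * (4 * real DIM('a) * h) ^ DIM('a)))"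
proof -
  let ?Q = "cbox a (a + h *\<^sub>R One)"
  define R where "R = 2 * real DIM('a) * h"
  define B where "B = ball a (2 * R)"
  define g1 where "g1 = (\<lambda>y. g y * indicator B y)"
  have R: "0 < R" using h by (simp add: R_def)
  have l0: "0 < l" using l m by (smt (verit) mult_pos_pos zero_less_power)
  have a: "a \<in> ?Q" using h by (auto simp: mem_box inner_add_left)
  have near: "dist u y < R" if "u \<in> ?Q" "y \<in> ?Q" for u y
    using dist_cube_less[OF h that] by (simp add: R_def)
  have QB: "y \<in> B" if "y \<in> ?Q" for y
    using near[OF a that] R by (simp add: B_def)
  have [measurable]: "B \<in> sets lebesgue" by (simp add: B_def)
  have g1[measurable]: "g1 \<in> borel_measurable lebesgue" unfolding g1_def by measurable
  have eB: "emeasure lebesgue B = ennreal (unit_ball_vol (real DIM('a)) * (4 * real DIM('a) * h) ^ DIM('a))"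
  proof -
    have "2 * R = 4 * real DIM('a) * h" by (simp add: R_def)
    then have "B = ball a (4 * real DIM('a) * h)" by (simp only: B_def)
    moreover have "0 \<le> 4 * real DIM('a) * h" using h by simp
    ultimately show ?thesis using emeasure_lebesgue_ball by blast
  qed
  have sub: "{y \<in> ?Q. ennreal l < hl_max g y} \<subseteq> {y. ennreal l < hl_max g1 y}"
  proof clarify
    fix y assume y: "y \<in> ?Q" and ly: "ennreal l < hl_max g y"
    from ly consider "ennreal l < g y" | c r where "y \<in> ball c r" "ennreal l < ball_mean g c r"
      by (auto simp: less_hl_max_iff)
    then show "ennreal l < hl_max g1 y"
    proof cases
      case 1
      then show ?thesis using QB[OF y] by (simp add: less_hl_max_iff g1_def)
    next
      case (2 c r)
      then have r: "0 < r" by (metis ball_eq_empty empty_iff not_le)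
      have yc: "dist y c < r" using 2 by (simp add: dist_commute)
      show ?thesis
      \<comment> \<open>If 2r > R, then x is within R + r < 3r of c. Otherwise every point of the
        ball is within R + 2r <= 2R of a, and 2R is the radius of \<open>B\<close>.\<close>
      proof (cases "R < 2 * r")
        case True
        have "dist x c < 5 * r"
          using near[OF x y] yc True r dist_triangle[of x c y] by simp
        then have x5: "x \<in> ball c (5 * r)" by (simp add: dist_commute)
        have "ball c r \<subseteq> ball c (5 * r)" using r by (intro subset_ball) simp
        then have "(\<integral>\<^sup>+y\<in>ball c r. g y \<partial>lebesgue) \<le> (\<integral>\<^sup>+y\<in>ball c (5 * r). g y \<partial>lebesgue)"
          by (intro nn_integral_mono) (auto split: split_indicator)
        also have "\<dots> = ball_mean g c (5 * r) * emeasure lebesgue (ball c (5 * r))"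
          using r by (simp only: ball_mean_mult)
        also have "\<dots> \<le> ennreal m * emeasure lebesgue (ball c (5 * r))"
          by (intro mult_right_mono order_trans[OF ball_mean_le_hl_max[OF x5] m(1)]) simp
        also have "\<dots> = ennreal (5 ^ DIM('a) * m) * emeasure lebesgue (ball c r)"
          using emeasure_ball_scale[of r 5 c c] r m by (simp add: ennreal_mult mult_ac)
        also have "\<dots> \<le> ennreal l * emeasure lebesgue (ball c r)"
          using l by (intro mult_right_mono ennreal_leI) auto
        finally have "\<not> ennreal l < ball_mean g c r"
          by (simp only: less_ball_mean_iff[OF r] not_less)
        then show ?thesis using 2 by simp
      next
        case False
        have "ball c r \<subseteq> B"
        proof
          fix z assume "z \<in> ball c r"
          then have "dist a z < 2 * R"
            using near[OF a y] yc False dist_triangle[of a z y] dist_triangle[of y z c]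
            by (simp add: dist_commute)
          then show "z \<in> B" by (simp add: B_def)
        qed
        then have "ball_mean g1 c r = ball_mean g c r"
          unfolding ball_mean_def g1_def
          by (intro arg_cong2[of _ _ _ _ "(/)"] nn_integral_cong refl) (auto split: split_indicator)
        then show ?thesis using 2 unfolding less_hl_max_iff by metis
      qed
    qed
  qed
  have "{y. ennreal l < hl_max g1 y} \<in> sets lebesgue"
    by (intro sets_lebesgue_greater borel_measurable_hl_max g1)
  then have "ennreal l * emeasure lebesgue {y \<in> ?Q. ennreal l < hl_max g y}
      \<le> ennreal l * emeasure lebesgue {y. ennreal l < hl_max g1 y}"
    by (intro mult_left_mono emeasure_mono sub) auto
  also have "\<dots> \<le> ennreal (5 ^ DIM('a) + 1) * (\<integral>\<^sup>+y. g1 y \<partial>lebesgue)"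
    by (rule hl_max_weak_type[OF g1 l0])
  also have "(\<integral>\<^sup>+y. g1 y \<partial>lebesgue) = ball_mean g a (2 * R) * emeasure lebesgue B"
    using R unfolding B_def by (subst ball_mean_mult) (auto simp: g1_def B_def)
  also have "ennreal (5 ^ DIM('a) + 1) * \<dots> \<le> ennreal (5 ^ DIM('a) + 1) * (ennreal m * emeasure lebesgue B)"
    using QB[OF x] by (intro mult_left_mono mult_right_mono order_trans[OF ball_mean_le_hl_max m(1)]) (auto simp: B_def)
  also have "\<dots> = ennreal ((5 ^ DIM('a) + 1) * m * (unit_ball_vol (real DIM('a)) * (4 * real DIM('a) * h) ^ DIM('a)))"
    using m h unfolding eB by (simp add: ennreal_mult[symmetric] mult.assoc del: ennreal_plus)
  finally show ?thesis .
qed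

text \<open>Coifman-Rochberg by Kolmogorov's inequality. Let m be the value of
  \<open>hl_max g\<close> at a point of Q. Above the height 5^n m, \<open>hl_max_localized\<close>
  gives a weak L^1 bound on Q of size m |Q|, and theta < 1 turns it into an integral bound. In the
  constant, (5^n)^theta is the threshold, the summand 1 counts the points below it, and the rest is
  the tail. The only exceptional points are those where \<open>hl_max g\<close> is infinite.\<close>

theorem hl_max_powr_A1:
  fixes g :: "'a::euclidean_space \<Rightarrow> ennreal"
  defines "n \<equiv> real DIM('a)"
  assumes g[measurable]: "g \<in> borel_measurable lebesgue" and \<theta>: "0 < \<theta>" "\<theta> < 1"
    and pos: "\<And>x. 0 < hl_max g x" and fin: "AE x in lebesgue. hl_max g x < \<infinity>"
  shows "a1_bound ((5 powr n) powr \<theta> * (1 + 2 * (unit_ball_vol n * (4 * n) powr n) * (2 powr \<theta> / (1 - 2 powr (\<theta> - 1)))))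
    (\<lambda>x. enn2real (hl_max g x) powr \<theta>)"
  unfolding a1_bound_def
proof
  fix Q :: "'a set" assume "Q \<in> cubes"
  then obtain a h where h: "0 < h" and Q: "Q = cbox a (a + h *\<^sub>R One)" and Qm[measurable]: "Q \<in> sets lebesgue"
    and eQ: "emeasure lebesgue Q = ennreal (h ^ DIM('a))"
    by (rule cubesE)
  define v where "v x = enn2real (hl_max g x)" for x
  have vm[measurable]: "v \<in> borel_measurable lebesgue" unfolding v_def by measurable
  define c where "c = 2 powr \<theta> / (1 - 2 powr (\<theta> - 1))"
  have c: "0 < c" using powr_less_mono[of "\<theta> - 1" 0 2] \<theta> by (simp add: c_def)
  \<comment> \<open>The factor 2 absorbs (5^n + 1) / 5^n.\<close>
  define A where "A = 2 * (unit_ball_vol n * (4 * n * h) ^ DIM('a))"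
  have A: "0 \<le> A" using h by (simp add: A_def n_def)
  let ?C = "(5 powr n) powr \<theta> * (1 + 2 * (unit_ball_vol n * (4 * n) powr n) * c)"
  have "avg Q (\<lambda>y. v y powr \<theta>) \<le> ennreal (?C * v x powr \<theta>)" if x: "x \<in> Q" and xf: "hl_max g x < \<infinity>" for x
  proof -
    define m where "m = v x"
    have m: "hl_max g x = ennreal m" "0 < m"
      using xf pos[of x] by (auto simp: m_def v_def enn2real_positive_iff)
    define L where "L = 5 ^ DIM('a) * m"
    have L: "0 < L" using m by (simp add: L_def)
    define F where "F y = indicator Q y * (v y / L)" for y
    have [measurable]: "F \<in> borel_measurable lebesgue" unfolding F_def by measurable
    have tail: "emeasure lebesgue {y \<in> space lebesgue. l < F y} \<le> ennreal (A * l powr - 1)" if l: "1 \<le> l" for l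
    proof -
      have lL: "0 < l * L" using l L by simp
      have "{y \<in> space lebesgue. l < F y} \<subseteq> {y \<in> cbox a (a + h *\<^sub>R One). ennreal (l * L) < hl_max g y}"
      proof
        fix y assume "y \<in> {y \<in> space lebesgue. l < F y}"
        then have lF: "l < F y" by simp
        have yQ: "y \<in> Q"
        proof (rule ccontr)
          assume "y \<notin> Q"
          then show False using lF l by (simp add: F_def)
        qed
        moreover have "l * L < v y"
          using lF yQ L by (simp add: F_def pos_less_divide_eq)
        moreover from this have "ennreal (l * L) < hl_max g y"
          using lL by (cases "hl_max g y") (auto simp: v_def ennreal_less_iff)
        ultimately show "y \<in> {y \<in> cbox a (a + h *\<^sub>R One). ennreal (l * L) < hl_max g y}"
          by (simp add: Q)
      qed
      moreover have "{y \<in> cbox a (a + h *\<^sub>R One). ennreal (l * L) < hl_max g y} \<in> sets lebesgue"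
        using sets.Int[OF Qm sets_lebesgue_greater[OF borel_measurable_hl_max[OF g], of "ennreal (l * L)"]]
        unfolding Q by (simp add: Int_def)
      ultimately have "ennreal (l * L) * emeasure lebesgue {y \<in> space lebesgue. l < F y}
          \<le> ennreal (l * L) * emeasure lebesgue {y \<in> cbox a (a + h *\<^sub>R One). ennreal (l * L) < hl_max g y}"
        by (intro mult_left_mono emeasure_mono) auto
      also have "\<dots> \<le> ennreal ((5 ^ DIM('a) + 1) * m * (unit_ball_vol n * (4 * n * h) ^ DIM('a)))"
        unfolding n_def
        using l L m by (intro hl_max_localized[OF g h x[unfolded Q]]) (auto simp: L_def[symmetric])
      also have "\<dots> \<le> ennreal (L * A)"
      proof (rule ennreal_leI)
        have "(5 ^ DIM('a) + 1) \<le> (2 * 5 ^ DIM('a) :: real)" by simp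
        then have "(5 ^ DIM('a) + 1) * (m * (unit_ball_vol n * (4 * n * h) ^ DIM('a)))
          \<le> 2 * 5 ^ DIM('a) * (m * (unit_ball_vol n * (4 * n * h) ^ DIM('a)))"
          using m h by (intro mult_right_mono) (auto simp: n_def)
        then show "(5 ^ DIM('a) + 1) * m * (unit_ball_vol n * (4 * n * h) ^ DIM('a)) \<le> L * A"
          by (simp add: L_def A_def mult_ac)
      qed
      also have "\<dots> = ennreal (l * L) * ennreal (A * l powr - 1)"
        using l L A by (simp add: ennreal_mult[symmetric] powr_minus_divide)
      finally show ?thesis
        using lL by (subst (asm) ennreal_mult_le_mult_iff) auto
    qed
    have "(\<integral>\<^sup>+y\<in>{y. 1 < F y}. ennreal (F y powr \<theta>) \<partial>lebesgue) \<le> ennreal (A * c)"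
      unfolding c_def by (rule nn_integral_upper_tail[where a = 1]) (use \<theta> A tail in auto)
    note hi = this
    have "(\<integral>\<^sup>+y\<in>Q. ennreal (v y powr \<theta>) \<partial>lebesgue)
        \<le> (\<integral>\<^sup>+y. ennreal (L powr \<theta>) * (indicator Q y + ennreal (F y powr \<theta>) * indicator {y. 1 < F y} y) \<partial>lebesgue)"
    proof (rule nn_integral_mono)
      fix y
      show "ennreal (v y powr \<theta>) * indicator Q y
        \<le> ennreal (L powr \<theta>) * (indicator Q y + ennreal (F y powr \<theta>) * indicator {y. 1 < F y} y)"
      proof (cases "y \<in> Q")
        case y: True
        have v0: "0 \<le> v y" by (simp add: v_def)
        then have "v y powr \<theta> = L powr \<theta> * F y powr \<theta>"
          using L y by (simp add: F_def powr_mult[symmetric])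
        moreover have "F y powr \<theta> \<le> 1" if "F y \<le> 1"
          using that v0 L \<theta> y by (intro powr_le1) (auto simp: F_def)
        ultimately show ?thesis
          using y by (cases "1 < F y") (auto simp: ennreal_mult distrib_left mult_left_le
             intro!: add_increasing)
      qed simp
    qed
    also have "\<dots> = ennreal (L powr \<theta>) * (emeasure lebesgue Q + (\<integral>\<^sup>+y\<in>{y. 1 < F y}. ennreal (F y powr \<theta>) \<partial>lebesgue))"
      by (subst nn_integral_cmult) (auto simp: nn_integral_add)
    also have "\<dots> \<le> ennreal (L powr \<theta>) * (ennreal (h ^ DIM('a)) + ennreal (A * c))"
      unfolding eQ by (intro mult_left_mono add_left_mono hi) simp
    also have "\<dots> = ennreal (?C * v x powr \<theta>) * ennreal (h ^ DIM('a))"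
    proof -
      have "L powr \<theta> = (5 powr n) powr \<theta> * v x powr \<theta>"
        using m by (simp add: L_def m_def[symmetric] powr_mult n_def powr_realpow)
      moreover have "h ^ DIM('a) + A * c = (1 + 2 * (unit_ball_vol n * (4 * n) powr n) * c) * h ^ DIM('a)"
        by (simp add: A_def n_def powr_realpow power_mult_distrib algebra_simps)
      ultimately show ?thesis
        using A c h
        by (simp add: ennreal_plus[symmetric] ennreal_mult[symmetric] mult_ac n_def del: ennreal_plus)
    qed
    finally show ?thesis
      unfolding avg_def eQ using h by (subst divide_le_posI_ennreal) (auto simp: mult.commute)
  qed
  then show "AE x in lebesgue. x \<in> Q \<longrightarrow> avg Q (\<lambda>x. enn2real (hl_max g x) powr \<theta>) \<le>
      ennreal ((5 powr n) powr \<theta> * (1 + 2 * (unit_ball_vol n * (4 * n) powr n) * (2 powr \<theta> / (1 - 2 powr (\<theta> - 1)))) * enn2real (hl_max g x) powr \<theta>)"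
    using fin unfolding v_def c_def by (auto elim!: eventually_mono)
qed

section \<open>Ap weights from A1 weights\<close>

lemma epowr_ennreal: "0 \<le> x \<Longrightarrow> ennreal x epowr a = ennreal (x powr a)"
  by (simp add: epowr_def)

lemma epowr_mono:
  assumes "x \<le> y" "0 \<le> a"
  shows "x epowr a \<le> y epowr a"
proof (cases "y = \<infinity>")
  case True
  then show ?thesis by (simp add: epowr_def)
next
  case False
  then obtain s where y: "y = ennreal s" "0 \<le> s" by (cases y) auto
  with assms obtain r where x: "x = ennreal r" "0 \<le> r" by (cases x) (auto simp: top_unique)
  show ?thesis using assms x y by (simp add: epowr_ennreal powr_mono2 ennreal_leI)
qed

lemma epowr_le_iff_root:
  assumes "0 < a" "0 \<le> c"
  shows "x epowr (1 / a) \<le> ennreal c \<longleftrightarrow> x \<le> ennreal (c powr a)"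
proof (cases x)
  case (real r)
  have "r powr (1 / a) \<le> c \<longleftrightarrow> r \<le> c powr a"
  proof
    assume "r powr (1 / a) \<le> c"
    then have "(r powr (1 / a)) powr a \<le> c powr a" using assms by (intro powr_mono2) auto
    then show "r \<le> c powr a" using assms real by (simp add: powr_powr)
  next
    assume "r \<le> c powr a"
    then have "r powr (1 / a) \<le> (c powr a) powr (1 / a)" using assms real by (intro powr_mono2) auto
    then show "r powr (1 / a) \<le> c" using assms by (simp add: powr_powr)
  qed
  then show ?thesis using real assms by (simp add: epowr_ennreal)
qed (use assms in \<open>simp add: epowr_def top_unique\<close>)

lemma avg_le_cmult:
  assumes "Q \<in> sets lebesgue" "g \<in> borel_measurable lebesgue" "0 \<le> c"
    and le: "AE x in lebesgue. x \<in> Q \<longrightarrow> f x \<le> c * g x"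
  shows "avg Q f \<le> ennreal c * avg Q g"
proof -
  have "(\<integral>\<^sup>+x\<in>Q. ennreal (f x) \<partial>lebesgue) \<le> (\<integral>\<^sup>+x. ennreal c * (ennreal (g x) * indicator Q x) \<partial>lebesgue)"
    using le
  proof (intro nn_integral_mono_AE, elim eventually_mono)
    fix x assume "x \<in> Q \<longrightarrow> f x \<le> c * g x"
    then show "ennreal (f x) * indicator Q x \<le> ennreal c * (ennreal (g x) * indicator Q x)"
      using assms(3) by (cases "0 \<le> g x") (auto simp: ennreal_mult[symmetric] ennreal_leI
        ennreal_neg mult_nonneg_nonpos ennreal_eq_0_iff intro: order_trans split: split_indicator)
  qed
  also have "\<dots> = ennreal c * (\<integral>\<^sup>+x\<in>Q. ennreal (g x) \<partial>lebesgue)"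
    using assms by (intro nn_integral_cmult) auto
  finally show ?thesis
    unfolding avg_def by (simp add: divide_right_mono_ennreal ennreal_times_divide)
qed

text \<open>Here \<open>\<alpha>\<close> is the average divided by C. The average is finite because
  it is bounded by a finite value at some point of the non-null cube, and positive because v is.
  Expressing the average and the lower bound by the same number prepares the cancellation in the A_p
  product.\<close>

lemma a1_boundE:
  fixes v :: "'a::euclidean_space \<Rightarrow> real"
  assumes v[measurable]: "v \<in> borel_measurable lebesgue" and pos: "AE x in lebesgue. 0 < v x"
    and C: "a1_bound C v" "0 < C" and Q: "Q \<in> cubes"
  obtains \<alpha> where "0 < \<alpha>" "avg Q v = ennreal (C * \<alpha>)" "AE x in lebesgue. x \<in> Q \<longrightarrow> \<alpha> \<le> v x"
proof -
  obtain a h where h: "0 < h" and Qm[measurable]: "Q \<in> sets lebesgue"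
    and eQ: "emeasure lebesgue Q = ennreal (h ^ DIM('a))"
    using Q by (rule cubesE)
  have nn: "\<not> (AE x in lebesgue. x \<notin> Q)"
    using h eQ Qm by (subst AE_iff_null_sets[symmetric]) (auto simp: null_sets_def ennreal_eq_0_iff not_le)
  have AE: "AE x in lebesgue. x \<in> Q \<longrightarrow> avg Q v \<le> ennreal (C * v x)"
    using C Q by (auto simp: a1_bound_def)
  have "avg Q v \<noteq> \<infinity>"
  proof
    assume "avg Q v = \<infinity>"
    then have "AE x in lebesgue. x \<notin> Q" using AE by (auto elim!: eventually_mono simp: top_unique)
    then show False using nn by simp
  qed
  moreover have "avg Q v \<noteq> 0"
  proof
    assume "avg Q v = 0"
    then have "(\<integral>\<^sup>+x\<in>Q. ennreal (v x) \<partial>lebesgue) = 0"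
      using eQ by (auto simp: avg_def)
    then have "AE x in lebesgue. ennreal (v x) * indicator Q x = 0"
      by (subst (asm) nn_integral_0_iff_AE) auto
    with pos have "AE x in lebesgue. x \<notin> Q"
      by eventually_elim (auto split: split_indicator_asm simp: ennreal_eq_0_iff)
    then show False using nn by simp
  qed
  ultimately obtain r where r: "avg Q v = ennreal r" "0 < r"
    by (cases "avg Q v") (auto simp: less_le)
  show thesis
  proof (rule that[of "r / C"])
    show "0 < r / C" "avg Q v = ennreal (C * (r / C))" using r C by auto
    show "AE x in lebesgue. x \<in> Q \<longrightarrow> r / C \<le> v x"
      using AE pos
    proof eventually_elim
      case (elim x)
      then show ?case using r C by (auto simp: field_simps mult_le_0_iff)
    qed
  qed
qed

text \<open>The elementary direction of the Jones factorization theorem. Let u = v0 v1^(1-p) and p >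
  1. On a cube, v1 >= beta gives u <= beta^(1-p) v0, and v0 >= alpha gives u^(-1/(p-1)) <=
  alpha^(-1/(p-1)) v1. The averages of v0 and v1 are C0 alpha and C1 beta, so alpha and beta cancel
  in the product.\<close>

theorem Ap_const_factorization:
  fixes v0 v1 :: "'a::euclidean_space \<Rightarrow> real"
  assumes [measurable]: "v0 \<in> borel_measurable lebesgue" "v1 \<in> borel_measurable lebesgue"
    and pos: "AE x in lebesgue. 0 < v0 x" "AE x in lebesgue. 0 < v1 x"
    and C0: "a1_bound C0 v0" "0 < C0" and C1: "a1_bound C1 v1" "0 < C1" and p: "1 \<le> p"
  shows "Ap_const p (\<lambda>x. v0 x * v1 x powr (1 - p)) \<le> ennreal (C0 * C1 powr (p - 1))"
proof (cases "p = 1")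
  case True
  let ?u = "\<lambda>x. v0 x * v1 x powr (1 - p)"
  \<comment> \<open>Only almost everywhere, since \<open>0 powr 0\<close> is 0.\<close>
  have u: "AE x in lebesgue. ?u x = v0 x"
    using pos by eventually_elim (simp add: True)
  have "avg Q ?u * esssup (lebesgue_on Q) (\<lambda>x. inverse (ennreal (?u x))) \<le> ennreal C0"
    if Q: "Q \<in> cubes" for Q :: "'a set"
  proof -
    have Qm[measurable]: "Q \<in> sets lebesgue" using Q by (rule cubesE)
    obtain \<alpha> where \<alpha>: "0 < \<alpha>" "avg Q v0 = ennreal (C0 * \<alpha>)" "AE x in lebesgue. x \<in> Q \<longrightarrow> \<alpha> \<le> v0 x"
      by (rule a1_boundE[OF _ pos(1) C0 Q]) auto
    have "avg Q ?u \<le> ennreal 1 * avg Q v0"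
      using u by (intro avg_le_cmult) (auto elim: eventually_mono)
    moreover have "esssup (lebesgue_on Q) (\<lambda>x. inverse (ennreal (?u x))) \<le> ennreal (1 / \<alpha>)"
    proof (rule esssup_I)
      have "AE x in lebesgue. x \<in> Q \<longrightarrow> inverse (ennreal (?u x)) \<le> ennreal (1 / \<alpha>)"
        using u \<alpha>(3)
      proof eventually_elim
        case (elim x)
        then show ?case using \<alpha>(1)
          by (auto simp: inverse_ennreal inverse_eq_divide intro!: ennreal_leI divide_left_mono)
      qed
      then show "AE x in lebesgue_on Q. inverse (ennreal (?u x)) \<le> ennreal (1 / \<alpha>)"
        by (subst AE_restrict_space_iff) auto
    qed (intro measurable_restrict_space1, measurable)
    ultimately have "avg Q ?u * esssup (lebesgue_on Q) (\<lambda>x. inverse (ennreal (?u x)))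
        \<le> ennreal (C0 * \<alpha>) * ennreal (1 / \<alpha>)"
      using \<alpha>(2) by (intro mult_mono) auto
    also have "\<dots> = ennreal C0"
      using \<alpha> C0 by (simp add: ennreal_mult[symmetric])
    finally show ?thesis .
  qed
  then show ?thesis using True C1 by (auto simp: Ap_const_def intro!: SUP_least)
next
  case False
  with p have p: "1 < p" by simp
  let ?u = "\<lambda>x. v0 x * v1 x powr (1 - p)"
  have "avg Q ?u * avg Q (\<lambda>x. ?u x powr (- 1 / (p - 1))) epowr (p - 1) \<le> ennreal (C0 * C1 powr (p - 1))"
    if Q: "Q \<in> cubes" for Q :: "'a set"
  proof -
    have Qm[measurable]: "Q \<in> sets lebesgue" using Q by (rule cubesE)
    obtain \<alpha> where \<alpha>: "0 < \<alpha>" "avg Q v0 = ennreal (C0 * \<alpha>)" "AE x in lebesgue. x \<in> Q \<longrightarrow> \<alpha> \<le> v0 x"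
      by (rule a1_boundE[OF _ pos(1) C0 Q]) auto
    obtain \<beta> where \<beta>: "0 < \<beta>" "avg Q v1 = ennreal (C1 * \<beta>)" "AE x in lebesgue. x \<in> Q \<longrightarrow> \<beta> \<le> v1 x"
      by (rule a1_boundE[OF _ pos(2) C1 Q]) auto
    have "avg Q ?u \<le> ennreal (\<beta> powr (1 - p)) * avg Q v0"
    proof (rule avg_le_cmult)
      show "AE x in lebesgue. x \<in> Q \<longrightarrow> ?u x \<le> \<beta> powr (1 - p) * v0 x"
        using \<beta>(3) pos(1)
      proof eventually_elim
        case (elim x)
        then show ?case using \<beta>(1) p by (auto simp: mult.commute intro!: powr_mono2')
      qed
    qed auto
    also have "\<dots> = ennreal (\<beta> powr (1 - p) * (C0 * \<alpha>))"
      using \<alpha> C0 by (simp add: ennreal_mult[symmetric])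
    finally have 1: "avg Q ?u \<le> ennreal (\<beta> powr (1 - p) * (C0 * \<alpha>))" .
    have "avg Q (\<lambda>x. ?u x powr (- 1 / (p - 1))) \<le> ennreal (\<alpha> powr (- 1 / (p - 1))) * avg Q v1"
    proof (rule avg_le_cmult)
      show "AE x in lebesgue. x \<in> Q \<longrightarrow> ?u x powr (- 1 / (p - 1)) \<le> \<alpha> powr (- 1 / (p - 1)) * v1 x"
        using \<alpha>(3) pos
      proof eventually_elim
        case (elim x)
        have "(1 - p) * (- 1 / (p - 1)) = 1" using p by (simp add: field_simps)
        then have "?u x powr (- 1 / (p - 1)) = v0 x powr (- 1 / (p - 1)) * v1 x"
          using elim by (simp only: powr_mult powr_powr) simp
        moreover have "v0 x powr (- 1 / (p - 1)) \<le> \<alpha> powr (- 1 / (p - 1))" if "x \<in> Q"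
          using elim \<alpha>(1) p that by (intro powr_mono2') auto
        ultimately show ?case using elim by (auto intro!: mult_right_mono)
      qed
    qed auto
    also have "\<dots> = ennreal (\<alpha> powr (- 1 / (p - 1)) * (C1 * \<beta>))"
      using \<beta> C1 by (simp add: ennreal_mult[symmetric])
    finally have "avg Q (\<lambda>x. ?u x powr (- 1 / (p - 1))) epowr (p - 1)
        \<le> ennreal (\<alpha> powr (- 1 / (p - 1)) * (C1 * \<beta>)) epowr (p - 1)"
      using p by (intro epowr_mono) auto
    also have "\<dots> = ennreal (C1 powr (p - 1) * \<beta> powr (p - 1) / \<alpha>)"
    proof -
      have "- 1 / (p - 1) * (p - 1) = - 1" using p by simp
      then have "(\<alpha> powr (- 1 / (p - 1)) * (C1 * \<beta>)) powr (p - 1) = \<alpha> powr (- 1) * (C1 powr (p - 1) * \<beta> powr (p - 1))"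
        by (simp only: powr_mult powr_powr)
      then show ?thesis
        using \<alpha> \<beta> C1 by (simp add: epowr_ennreal powr_minus_divide)
    qed
    finally have 2: "avg Q (\<lambda>x. ?u x powr (- 1 / (p - 1))) epowr (p - 1) \<le> \<dots>" .
    have "avg Q ?u * avg Q (\<lambda>x. ?u x powr (- 1 / (p - 1))) epowr (p - 1)
        \<le> ennreal (\<beta> powr (1 - p) * (C0 * \<alpha>)) * ennreal (C1 powr (p - 1) * \<beta> powr (p - 1) / \<alpha>)"
      by (intro mult_mono 1 2) auto
    also have "\<dots> = ennreal (C0 * C1 powr (p - 1))"
    proof -
      have "\<beta> powr (1 - p) * \<beta> powr (p - 1) = 1"
        using \<beta> by (simp add: powr_add[symmetric])
      then show ?thesis
        using \<alpha> \<beta> C0 C1 by (simp add: ennreal_mult[symmetric] mult_ac)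
    qed
    finally show ?thesis .
  qed
  then show ?thesis using False by (auto simp: Ap_const_def intro!: SUP_least)
qed

section \<open>Finiteness and positivity of the maximal function\<close>

lemma AE_hl_max_finite:
  fixes g :: "'a::euclidean_space \<Rightarrow> ennreal"
  assumes g[measurable]: "g \<in> borel_measurable lebesgue" and fin: "(\<integral>\<^sup>+x. g x \<partial>lebesgue) < \<infinity>"
  shows "AE x in lebesgue. hl_max g x < \<infinity>"
proof -
  define c where "c = enn2real (ennreal (5 ^ DIM('a) + 1) * (\<integral>\<^sup>+x. g x \<partial>lebesgue))"
  have c: "ennreal (5 ^ DIM('a) + 1) * (\<integral>\<^sup>+x. g x \<partial>lebesgue) = ennreal c"
    using fin unfolding c_def by (subst ennreal_enn2real) (simp_all add: ennreal_mult_less_top del: ennreal_plus)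
  have c0: "0 \<le> c" by (simp add: c_def)
  let ?N = "{x \<in> space lebesgue. \<not> hl_max g x < \<infinity>}"
  have N: "?N \<in> sets lebesgue" by measurable
  have le: "ennreal l * emeasure lebesgue ?N \<le> ennreal c" if l: "0 < l" for l
  proof -
    have "emeasure lebesgue ?N \<le> emeasure lebesgue {x. ennreal l < hl_max g x}"
      by (intro emeasure_mono sets_lebesgue_greater borel_measurable_hl_max g)
         (auto simp: not_less top_unique)
    then have "ennreal l * emeasure lebesgue ?N \<le> ennreal l * emeasure lebesgue {x. ennreal l < hl_max g x}"
      by (rule mult_left_mono) simp
    also have "\<dots> \<le> ennreal c"
      using hl_max_weak_type[OF g l] unfolding c .
    finally show ?thesis .
  qed
  have "emeasure lebesgue ?N = 0"
  proof (rule ccontr)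
    assume "emeasure lebesgue ?N \<noteq> 0"
    then consider "emeasure lebesgue ?N = \<infinity>" | r where "0 < r" "emeasure lebesgue ?N = ennreal r"
      by (cases "emeasure lebesgue ?N") (auto simp: less_le)
    then show False
    proof cases
      case 1
      then show False using le[of 1] by (simp add: top_unique)
    next
      case (2 r)
      \<comment> \<open>At this level the left side is c + 1.\<close>
      then show False using le[of "(c + 1) / r"] c0 by (simp add: ennreal_mult[symmetric])
    qed
  qed
  then show ?thesis
    using N by (intro AE_I[of _ _ ?N]) auto
qed

text \<open>If the maximal function vanished at x, then g would vanish a.e. on every ball around x,
  and countably many of these exhaust the space.\<close>

lemma hl_max_pos:
  fixes g :: "'a::euclidean_space \<Rightarrow> ennreal"
  assumes g[measurable]: "g \<in> borel_measurable lebesgue" and nz: "(\<integral>\<^sup>+x. g x \<partial>lebesgue) \<noteq> 0"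
  shows "0 < hl_max g x"
proof (rule ccontr)
  assume "\<not> 0 < hl_max g x"
  then have z: "hl_max g x = 0" by simp
  have [measurable]: "ball x r \<in> sets lebesgue" for r by simp
  have "AE y in lebesgue. \<forall>i::nat. g y * indicator (ball x (Suc i)) y = 0"
  proof (subst AE_all_countable, rule allI)
    fix i :: nat
    have "ball_mean g x (Suc i) = 0"
      using ball_mean_le_hl_max[of x x "Suc i" g] z by simp
    then have "(\<integral>\<^sup>+y\<in>ball x (Suc i). g y \<partial>lebesgue) = 0"
      using ball_mean_mult[of "Suc i" g x] by simp
    then show "AE y in lebesgue. g y * indicator (ball x (Suc i)) y = 0"
      by (subst (asm) nn_integral_0_iff_AE) auto
  qed
  then have "AE y in lebesgue. g y = 0"
  proof (rule eventually_mono)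
    fix y assume *: "\<forall>i::nat. g y * indicator (ball x (Suc i)) y = 0"
    obtain i :: nat where "dist x y < i" using reals_Archimedean2 by blast
    then have "y \<in> ball x (Suc i)" by simp
    then show "g y = 0" using *[rule_format, of i] by simp
  qed
  then show False using nz by (subst (asm) nn_integral_0_iff_AE) auto
qed

section \<open>The extrapolation weight\<close>

text \<open>\<open>G\<close> stands for |f|/B, and \<open>a\<close>, \<open>b\<close> for 1/delta
  and 1/(1-mu). The constants are fixed before \<open>G\<close>, \<open>t\<close> and
  \<open>F\<close>. Both integral bounds are multiples of |F|, so |F| cancels once they are inserted
  into the weak type inequality.\<close>

theorem exists_extrapolation_weight:
  fixes a b p0 :: real
  assumes a: "1 < a" and b: "1 < b" and p0: "1 \<le> p0"
  obtains K0 K2 K3 :: real where "0 \<le> K0" "0 \<le> K2" "0 < K3"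
    "\<And>(G :: 'a::euclidean_space \<Rightarrow> real) t F.
      \<lbrakk>G \<in> borel_measurable lebesgue; \<And>x. 0 \<le> G x; 0 < t;
       \<And>l. 1 \<le> l \<Longrightarrow> emeasure lebesgue {x. l < G x} \<le> ennreal (t * l powr - a);
       \<And>l. 0 < l \<Longrightarrow> l \<le> 1 \<Longrightarrow> emeasure lebesgue {x. l < G x} \<le> ennreal (t * l powr - b);
       F \<in> sets lebesgue; ennreal t \<le> emeasure lebesgue F; emeasure lebesgue F < \<infinity>\<rbrakk> \<Longrightarrow>
      \<exists>u\<in>Ap p0. u \<in> borel_measurable lebesgue \<and> Ap_const p0 u \<le> ennreal K0
        \<and> (\<integral>\<^sup>+x. ennreal (G x powr p0) * ennreal (u x) \<partial>lebesgue) \<le> ennreal K2 * emeasure lebesgue F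
        \<and> ennreal K3 * emeasure lebesgue F \<le> (\<integral>\<^sup>+x\<in>F. ennreal (u x) \<partial>lebesgue)"
proof -
  define n where "n = real DIM('a)"
  define A1C where "A1C \<theta> = (5 powr n) powr \<theta> * (1 + 2 * (unit_ball_vol n * (4 * n) powr n) * (2 powr \<theta> / (1 - 2 powr (\<theta> - 1))))" for \<theta>
  have A1C: "0 < A1C \<theta>" if "0 < \<theta>" "\<theta> < 1" for \<theta>
    using powr_less_mono[of "\<theta> - 1" 0 2] that unfolding A1C_def n_def
    by (auto intro!: mult_pos_pos add_pos_nonneg mult_nonneg_nonneg divide_nonneg_pos)
  define D :: real where "D = 5 ^ DIM('a) + 1"
  have D: "0 < D" by (simp add: D_def add_pos_pos)
  \<comment> \<open>q < a makes G^q integrable over {G > 1}, and q > 1 makes 1/q an admissible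
    exponent in \<open>hl_max_powr_A1\<close>.\<close>
  define q where "q = (1 + a) / 2"
  have q: "1 < q" "q < a" using a by (auto simp: q_def)
  \<comment> \<open>The midpoint of b/(b+1) and 1. It gives gamma > 1, and then (M chi_F)^gamma is
    integrable, as M chi_F is bounded by 1 and in weak L^1.\<close>
  define \<theta> where "\<theta> = (2 * b + 1) / (2 * (b + 1))"
  have \<theta>: "0 < \<theta>" "\<theta> < 1" using b by (auto simp: \<theta>_def)
  define \<gamma> where "\<gamma> = \<theta> * ((b + 1) / b)"
  have "\<gamma> = (2 * b + 1) / (2 * b)" using b unfolding \<gamma>_def \<theta>_def times_divide_times_eq
    by (subst mult_divide_mult_cancel_right[of "b + 1", symmetric]) (auto simp: mult_ac)
  then have \<gamma>: "1 < \<gamma>" using b by simp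
  define chq where "chq = 2 powr q / (1 - 2 powr (q - a))"
  define ch1 where "ch1 = 2 powr 1 / (1 - 2 powr (1 - a))"
  define clo where "clo = 2 powr b / (1 - 2 powr (b - (b + 1)))"
  define cu where "cu = 2 powr 1 / (1 - 2 powr (1 - \<gamma>))"
  have cpos: "0 < chq" "0 < ch1" "0 < clo" "0 < cu"
    using powr_less_mono[of "q - a" 0 2] powr_less_mono[of "1 - a" 0 2] powr_less_mono[of "b - (b + 1)" 0 2]
      powr_less_mono[of "1 - \<gamma>" 0 2] q a b \<gamma> unfolding chq_def ch1_def clo_def cu_def
    by (auto intro!: divide_pos_pos)
  \<comment> \<open>Chosen so that the weak type bound D t chq / l0 for the set where the maximal
    function of \<open>gh\<close> exceeds l0 equals t / 2, at most half of |F|.\<close>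
  define l0 where "l0 = 2 * D * chq"
  have l0: "0 < l0" using D cpos by (simp add: l0_def)
  define K where "K = (1 + l0) powr (1 / q)"
  have K: "0 < K" using l0 by (simp add: K_def)
  show thesis
  proof (rule that[of "A1C \<theta> * A1C (1 / q) powr (p0 - 1)" "ch1 + clo + D * cu" "K powr (1 - p0) / 2"])
    show "0 \<le> A1C \<theta> * A1C (1 / q) powr (p0 - 1)" using A1C[OF \<theta>] by simp
    show "0 \<le> ch1 + clo + D * cu" using cpos D by simp
    show "0 < K powr (1 - p0) / 2" using K by simp
  next
    fix G :: "'a \<Rightarrow> real" and t :: real and F :: "'a set"
    assume G[measurable]: "G \<in> borel_measurable lebesgue" and G0: "\<And>x. 0 \<le> G x" and t: "0 < t"
      and hi: "\<And>l. 1 \<le> l \<Longrightarrow> emeasure lebesgue {x. l < G x} \<le> ennreal (t * l powr - a)"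
      and lo: "\<And>l. 0 < l \<Longrightarrow> l \<le> 1 \<Longrightarrow> emeasure lebesgue {x. l < G x} \<le> ennreal (t * l powr - b)"
      and F[measurable]: "F \<in> sets lebesgue" and tF: "ennreal t \<le> emeasure lebesgue F"
      and Ffin: "emeasure lebesgue F < \<infinity>"
    obtain m where m: "emeasure lebesgue F = ennreal m" "0 \<le> m"
      using Ffin by (cases "emeasure lebesgue F") auto
    have tm: "t \<le> m" using tF m t by (simp add: ennreal_le_iff)

    define h0 where "h0 = hl_max (indicator F :: 'a \<Rightarrow> ennreal)"
    have [measurable]: "h0 \<in> borel_measurable lebesgue" unfolding h0_def by measurable
    have h0_le: "h0 x \<le> 1" for x
      unfolding h0_def by (rule hl_max_le) (auto split: split_indicator)
    have h0_F: "h0 x = 1" if "x \<in> F" for x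
      using le_hl_max[of "indicator F" x] h0_le[of x] that by (simp add: h0_def)
    have h0_pos: "0 < h0 x" for x
      unfolding h0_def using m tm t by (intro hl_max_pos) auto
    define w0 where "w0 x = enn2real (h0 x)" for x
    have [measurable]: "w0 \<in> borel_measurable lebesgue" unfolding w0_def by measurable
    have w0: "h0 x = ennreal (w0 x)" "0 < w0 x" "w0 x \<le> 1" for x
    proof -
      have f: "h0 x < \<infinity>" using h0_le[of x] by (rule le_less_trans) simp
      then show e: "h0 x = ennreal (w0 x)" by (simp add: w0_def)
      show "0 < w0 x" using h0_pos[of x] f by (simp add: w0_def enn2real_positive_iff)
      show "w0 x \<le> 1" using h0_le[of x] unfolding e by simp
    qed
    define v0 where "v0 x = w0 x powr \<theta>" for x
    have [measurable]: "v0 \<in> borel_measurable lebesgue" unfolding v0_def by measurable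
    have v0: "0 < v0 x" "v0 x \<le> 1" for x
      using w0[of x] \<theta> by (auto simp: v0_def intro!: powr_le1)
    have v0_F: "v0 x = 1" if "x \<in> F" for x
      using h0_F[OF that] by (simp add: v0_def w0_def)
    have a0: "a1_bound (A1C \<theta>) v0"
      unfolding v0_def w0_def h0_def A1C_def n_def
      by (rule hl_max_powr_A1) (use \<theta> h0_pos w0(1) in \<open>auto simp: h0_def\<close>)
    have int0: "(\<integral>\<^sup>+x. ennreal (v0 x powr ((b + 1) / b)) \<partial>lebesgue) \<le> ennreal (D * m * cu)"
    proof -
      have "(\<integral>\<^sup>+x. ennreal (v0 x powr ((b + 1) / b)) \<partial>lebesgue)
          = (\<integral>\<^sup>+x\<in>{x. 0 \<le> w0 x \<and> w0 x \<le> 1}. ennreal (w0 x powr \<gamma>) \<partial>lebesgue)"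
        using w0 by (intro nn_integral_cong) (auto simp: v0_def powr_powr \<gamma>_def less_imp_le split: split_indicator)
      also have "\<dots> \<le> ennreal (D * m * cu)"
        unfolding cu_def
      proof (rule nn_integral_lower_tail)
        fix l :: real assume l: "0 < l" "l \<le> 1"
        have "ennreal l * emeasure lebesgue {x. ennreal l < h0 x} \<le> ennreal D * (\<integral>\<^sup>+x. indicator F x \<partial>lebesgue)"
          unfolding h0_def D_def using l by (intro hl_max_weak_type) auto
        also have "(\<integral>\<^sup>+x. indicator F x \<partial>lebesgue) = ennreal m" using m by simp
        also have "{x. ennreal l < h0 x} = {x \<in> space lebesgue. l < w0 x}"
          using l by (auto simp: w0(1) ennreal_less_iff)
        also have "ennreal D * ennreal m = ennreal l * ennreal (D * m * l powr - 1)"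
          using l D m by (simp add: ennreal_mult[symmetric] powr_minus_divide)
        finally show "emeasure lebesgue {x \<in> space lebesgue. l < w0 x} \<le> ennreal (D * m * l powr - 1)"
          using l by (subst (asm) ennreal_mult_le_mult_iff) auto
      qed (use \<gamma> D m in auto)
      finally show ?thesis .
    qed

    \<comment> \<open>The integrable part of G^q; the values where G <= 1 only add the constant 1 to
      the maximal function.\<close>
    define gh where "gh x = ennreal (G x powr q) * indicator {x. 1 < G x} x" for x
    define g1 where "g1 x = ennreal (max 1 (G x powr q))" for x
    have [measurable]: "gh \<in> borel_measurable lebesgue" "g1 \<in> borel_measurable lebesgue"
      unfolding gh_def g1_def by measurable
    have intgh: "(\<integral>\<^sup>+x. gh x \<partial>lebesgue) \<le> ennreal (t * chq)"
      unfolding gh_def chq_def by (rule nn_integral_upper_tail) (use q t hi in auto)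
    have g1_le: "g1 x \<le> 1 + gh x" for x
    proof (cases "1 < G x")
      case True
      have "ennreal (max 1 (G x powr q)) \<le> ennreal (1 + G x powr q)"
        by (intro ennreal_leI) auto
      then show ?thesis using True by (simp add: g1_def gh_def)
    next
      case False
      then have "G x powr q \<le> 1" using G0 q by (intro powr_le1) auto
      then show ?thesis using False by (simp add: g1_def gh_def max_def)
    qed
    define h1 where "h1 = hl_max g1"
    have [measurable]: "h1 \<in> borel_measurable lebesgue" unfolding h1_def by measurable
    have h1_le: "h1 x \<le> 1 + hl_max gh x" for x
      unfolding h1_def
      by (rule order_trans[OF hl_max_mono hl_max_add_const_le]) (auto intro: g1_le)
    have h1_ge: "g1 x \<le> h1 x" for x unfolding h1_def by (rule le_hl_max)
    have g1_ge: "1 \<le> g1 x" for x by (simp add: g1_def)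
    have h1_pos: "0 < h1 x" for x
      using order_trans[OF g1_ge h1_ge, of x] by (metis not_one_le_zero zero_less_iff_neq_zero)
    have h1_fin: "AE x in lebesgue. h1 x < \<infinity>"
    proof -
      have "AE x in lebesgue. hl_max gh x < \<infinity>"
        using intgh by (intro AE_hl_max_finite) (auto intro: le_less_trans)
      then show ?thesis
        by eventually_elim (use h1_le in \<open>auto intro!: le_less_trans[OF h1_le]\<close>)
    qed
    define w1 where "w1 x = enn2real (h1 x)" for x
    have [measurable]: "w1 \<in> borel_measurable lebesgue" unfolding w1_def by measurable
    have w1: "h1 x = ennreal (w1 x)" "1 \<le> w1 x" "G x powr q \<le> w1 x" if f: "h1 x < \<infinity>" for x
    proof -
      show e: "h1 x = ennreal (w1 x)" using f by (simp add: w1_def)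
      have w: "0 \<le> w1 x" by (simp add: w1_def)
      then have "max 1 (G x powr q) \<le> w1 x"
        using h1_ge[of x] unfolding e g1_def by (simp only: ennreal_le_iff)
      then show "1 \<le> w1 x" "G x powr q \<le> w1 x" by auto
    qed
    define v1 where "v1 x = w1 x powr (1 / q)" for x
    have [measurable]: "v1 \<in> borel_measurable lebesgue" unfolding v1_def by measurable
    have v1: "1 \<le> v1 x" "G x \<le> v1 x" if f: "h1 x < \<infinity>" for x
    proof -
      show "1 \<le> v1 x" using w1[OF f] q by (simp add: v1_def ge_one_powr_ge_zero)
      have "(G x powr q) powr (1 / q) \<le> v1 x"
        using w1[OF f] q unfolding v1_def by (intro powr_mono2) auto
      then show "G x \<le> v1 x" using q G0[of x] by (simp add: powr_powr)
    qed
    have a1: "a1_bound (A1C (1 / q)) v1"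
      unfolding v1_def w1_def h1_def A1C_def n_def
      by (rule hl_max_powr_A1) (use q h1_pos h1_fin in \<open>auto simp: h1_def\<close>)

    define u where "u x = v0 x * v1 x powr (1 - p0)" for x
    have [measurable]: "u \<in> borel_measurable lebesgue" unfolding u_def by measurable
    have u_pos: "AE x in lebesgue. 0 < u x"
      using h1_fin
    proof eventually_elim
      case (elim x)
      then show ?case using v0(1)[of x] v1(1)[OF elim] by (simp add: u_def)
    qed
    \<comment> \<open>This holds at every point: where \<open>h1\<close> is infinite,
      \<open>enn2real\<close> makes \<open>w1\<close> zero, and powers of 0 are 0.\<close>
    have v1p: "v1 x powr (1 - p0) \<le> 1" for x
    proof (cases "h1 x < \<infinity>")
      case True
      then have "v1 x powr (1 - p0) \<le> 1 powr (1 - p0)"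
        using v1[OF True] p0 by (intro powr_mono2') auto
      then show ?thesis by simp
    next
      case False
      then have "h1 x = top" by (simp add: less_top[symmetric])
      then show ?thesis by (simp add: v1_def w1_def)
    qed
    have u01: "0 \<le> u x" "u x \<le> 1" for x
      using v0[of x] v1p[of x] by (auto simp: u_def intro!: mult_le_one)
    have "weight u"
      unfolding weight_def
    proof (intro conjI ballI u_pos)
      fix Q :: "'a set" assume "Q \<in> cubes"
      then obtain a' h where h: "0 < h" and Qm[measurable]: "Q \<in> sets lebesgue"
        and eQ: "emeasure lebesgue Q = ennreal (h ^ DIM('a))" by (rule cubesE)
      show "set_integrable lebesgue Q u"
        unfolding set_integrable_def
      proof (rule Bochner_Integration.integrable_bound[of _ "indicator Q :: 'a \<Rightarrow> real"])
        show "integrable lebesgue (indicator Q :: 'a \<Rightarrow> real)"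
          using eQ by (simp add: integrable_indicator_iff)
        show "AE x in lebesgue. norm (indicat_real Q x *\<^sub>R u x) \<le> norm (indicator Q x :: real)"
          using u01 by (auto split: split_indicator)
      qed measurable
    qed
    moreover have Ap: "Ap_const p0 u \<le> ennreal (A1C \<theta> * A1C (1 / q) powr (p0 - 1))"
      unfolding u_def
    proof (rule Ap_const_factorization)
      show "AE x in lebesgue. 0 < v1 x" using h1_fin by eventually_elim (use v1 in force)
    qed (use a0 a1 v0 p0 A1C \<theta> q in auto)
    ultimately have uA: "u \<in> Ap p0"
      by (auto simp: Ap_def intro: le_less_trans)

    have upper: "(\<integral>\<^sup>+x. ennreal (G x powr p0) * ennreal (u x) \<partial>lebesgue) \<le> ennreal (ch1 + clo + D * cu) * emeasure lebesgue F"
    proof -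
      have "(\<integral>\<^sup>+x. ennreal (G x powr p0) * ennreal (u x) \<partial>lebesgue)
        \<le> (\<integral>\<^sup>+x. ennreal (G x powr 1) * indicator {x. 1 < G x} x
            + (ennreal (G x powr (b + 1)) * indicator {x. 0 \<le> G x \<and> G x \<le> 1} x
            + ennreal (v0 x powr ((b + 1) / b))) \<partial>lebesgue)"
      proof (rule nn_integral_mono_AE, use h1_fin in eventually_elim)
        case (elim x)
        \<comment> \<open>Since v1 >= G and 1 - p0 <= 0, the power p0 of G is reduced to the first
          power, whatever p0 is.\<close>
        have Gu: "G x powr p0 * u x \<le> G x * v0 x"
        proof (cases "G x = 0")
          case False
          then have Gx: "0 < G x" using G0[of x] by simp
          have "G x powr p0 * v1 x powr (1 - p0) \<le> G x powr p0 * G x powr (1 - p0)"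
            using v1[OF elim] p0 Gx by (intro mult_left_mono powr_mono2') auto
          also have "\<dots> = G x" using Gx by (simp add: powr_add[symmetric])
          finally show ?thesis using v0[of x] by (simp add: u_def mult.commute mult.left_commute)
        qed simp
        have "G x * v0 x \<le> G x powr (b + 1) / (b + 1) + v0 x powr ((b + 1) / b) / ((b + 1) / b)"
          using b v0[of x] G0[of x] by (intro Youngs_inequality) (auto simp: field_simps)
        also have "\<dots> \<le> G x powr (b + 1) + v0 x powr ((b + 1) / b)"
        proof -
          have d: "y / s \<le> y" if "0 \<le> y" "1 \<le> s" for y s :: real
            using that mult_left_mono[of 1 s y] by (simp add: divide_le_eq)
          show ?thesis using b by (intro add_mono d) auto
        qed
        finally have Y: "G x * v0 x \<le> \<dots>" .
        have "G x * v0 x \<le> G x" using v0[of x] G0[of x] by (simp add: mult_left_le)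
        then have "G x powr p0 * u x \<le> (if 1 < G x then G x powr 1 else G x powr (b + 1) + v0 x powr ((b + 1) / b))"
          using Gu Y G0[of x] by auto
        then show ?case using G0[of x] u01[of x]
          by (auto simp: ennreal_mult[symmetric] ennreal_plus[symmetric] simp del: ennreal_plus
            intro!: ennreal_leI intro: order_trans split: if_splits split_indicator)
      qed
      also have "\<dots> = (\<integral>\<^sup>+x\<in>{x. 1 < G x}. ennreal (G x powr 1) \<partial>lebesgue)
          + ((\<integral>\<^sup>+x\<in>{x. 0 \<le> G x \<and> G x \<le> 1}. ennreal (G x powr (b + 1)) \<partial>lebesgue)
          + (\<integral>\<^sup>+x. ennreal (v0 x powr ((b + 1) / b)) \<partial>lebesgue))"
        by (subst nn_integral_add; (subst nn_integral_add)?; measurable)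
      also have "\<dots> \<le> ennreal (t * ch1) + (ennreal (t * clo) + ennreal (D * m * cu))"
        unfolding ch1_def clo_def
        by (intro add_mono int0 nn_integral_upper_tail nn_integral_lower_tail) (use a b t hi lo in auto)
      also have "\<dots> = ennreal (t * ch1 + t * clo + D * m * cu)"
        using t m D cpos by (simp add: ennreal_plus[symmetric] add.assoc del: ennreal_plus)
      \<comment> \<open>The tails of G are measured by t and the conclusion by m = |F|; here t <=
        |F| enters.\<close>
      also have "\<dots> \<le> ennreal ((ch1 + clo + D * cu) * m)"
        using tm cpos by (intro ennreal_leI) (auto simp: algebra_simps intro!: add_mono mult_left_mono)
      also have "\<dots> = ennreal (ch1 + clo + D * cu) * emeasure lebesgue F"
        using m cpos D by (simp add: ennreal_mult)
      finally show ?thesis .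
    qed

    have lower: "ennreal (K powr (1 - p0) / 2) * emeasure lebesgue F \<le> (\<integral>\<^sup>+x\<in>F. ennreal (u x) \<partial>lebesgue)"
    proof -
      define H where "H = {x. ennreal l0 < hl_max gh x}"
      have [measurable]: "H \<in> sets lebesgue" unfolding H_def
        by (intro sets_lebesgue_greater borel_measurable_hl_max) measurable
      have "ennreal l0 * emeasure lebesgue H \<le> ennreal D * (\<integral>\<^sup>+x. gh x \<partial>lebesgue)"
        unfolding H_def D_def using l0 by (intro hl_max_weak_type) auto
      also have "\<dots> \<le> ennreal D * ennreal (t * chq)"
        by (intro mult_left_mono intgh) simp
      also have "\<dots> = ennreal l0 * ennreal (t / 2)"
        using D t cpos by (simp add: ennreal_mult[symmetric] l0_def)
      finally have "emeasure lebesgue H \<le> ennreal (t / 2)"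
        using l0 by (subst (asm) ennreal_mult_le_mult_iff) auto
      then have H: "emeasure lebesgue H \<le> ennreal (m / 2)"
        by (rule order_trans) (use tm in \<open>auto intro: ennreal_leI\<close>)
      have "emeasure lebesgue F \<le> emeasure lebesgue (F - H) + emeasure lebesgue H"
        by (intro order_trans[OF emeasure_mono emeasure_subadditive]) auto
      also have "\<dots> \<le> ennreal (m / 2) + emeasure lebesgue (F - H)"
        unfolding add.commute[of _ "emeasure lebesgue H"] by (intro add_right_mono H)
      finally have "ennreal (m / 2) + ennreal (m / 2) \<le> ennreal (m / 2) + emeasure lebesgue (F - H)"
        using m by (simp add: ennreal_plus[symmetric] del: ennreal_plus)
      then have FH: "ennreal (m / 2) \<le> emeasure lebesgue (F - H)"
        unfolding ennreal_add_left_cancel_le by simp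
      have "ennreal (K powr (1 - p0) / 2) * emeasure lebesgue F = ennreal (K powr (1 - p0)) * ennreal (m / 2)"
        using m by (simp add: ennreal_mult[symmetric])
      also have "\<dots> \<le> ennreal (K powr (1 - p0)) * emeasure lebesgue (F - H)"
        by (intro mult_left_mono FH) simp
      also have "\<dots> = (\<integral>\<^sup>+x. ennreal (K powr (1 - p0)) * indicator (F - H) x \<partial>lebesgue)"
        by (subst nn_integral_cmult_indicator) auto
      also have "\<dots> \<le> (\<integral>\<^sup>+x\<in>F. ennreal (u x) \<partial>lebesgue)"
      proof (rule nn_integral_mono)
        fix x
        have "K powr (1 - p0) \<le> u x" if x: "x \<in> F" "x \<notin> H"
        proof -
          have "h1 x \<le> 1 + ennreal l0"
            using x h1_le[of x] by (auto simp: H_def not_less intro: order_trans add_left_mono)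
          then have h: "h1 x \<le> ennreal (1 + l0)" using l0 by simp
          then have f: "h1 x < \<infinity>" by (rule le_less_trans) simp
          have "w1 x \<le> 1 + l0" using h l0 unfolding w1(1)[OF f] by (simp del: ennreal_plus)
          then have "v1 x \<le> K" using q w1[OF f] by (auto simp: v1_def K_def intro!: powr_mono2)
          then have "K powr (1 - p0) \<le> v1 x powr (1 - p0)"
            using v1[OF f] p0 by (intro powr_mono2') auto
          then show ?thesis using v0_F x by (simp add: u_def)
        qed
        then show "ennreal (K powr (1 - p0)) * indicator (F - H) x \<le> ennreal (u x) * indicator F x"
          by (auto split: split_indicator intro!: ennreal_leI)
      qed
      finally show ?thesis .
    qed
    show "\<exists>u\<in>Ap p0. u \<in> borel_measurable lebesgue \<and> Ap_const p0 u \<le> ennreal (A1C \<theta> * A1C (1 / q) powr (p0 - 1))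
        \<and> (\<integral>\<^sup>+x. ennreal (G x powr p0) * ennreal (u x) \<partial>lebesgue) \<le> ennreal (ch1 + clo + D * cu) * emeasure lebesgue F
        \<and> ennreal (K powr (1 - p0) / 2) * emeasure lebesgue F \<le> (\<integral>\<^sup>+x\<in>F. ennreal (u x) \<partial>lebesgue)"
      using uA Ap upper lower \<open>u \<in> borel_measurable lebesgue\<close> by blast
  qed
qed

text \<open>The two tail hypotheses describe f relative to a height B and a measure t. One K serves
  all f, t and B, so that the norm of f and the value h(t) can later enter through B alone.\<close>

theorem extrapolation_distribution:
  fixes T :: "('a::euclidean_space \<Rightarrow> 'k::real_normed_field) \<Rightarrow> ('a \<Rightarrow> 'k)"
  assumes p0: "1 \<le> p0" and lb: "locally_bounded \<phi>"
    and T: "\<And>u. u \<in> Ap p0 \<Longrightarrow> bounded_op T (Lp_norm p0 u) (weak_Lp_norm p0 u) (\<phi> (enn2real (Ap_const p0 u)))"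
    and ab: "1 < a" "1 < b"
  obtains K where "0 < K"
    "\<And>f t B. \<lbrakk>f \<in> borel_measurable lebesgue; 0 < t; 0 < B;
       \<And>l. 1 \<le> l \<Longrightarrow> emeasure lebesgue {x. l * B < norm (f x)} \<le> ennreal (t * l powr - a);
       \<And>l. 0 < l \<Longrightarrow> l \<le> 1 \<Longrightarrow> emeasure lebesgue {x. l * B < norm (f x)} \<le> ennreal (t * l powr - b)\<rbrakk>
      \<Longrightarrow> T f \<in> borel_measurable lebesgue \<and> emeasure lebesgue {x. K * B < norm (T f x)} \<le> ennreal t"
proof -
  obtain K0 K2 K3 :: real where K0: "0 \<le> K0" and K2: "0 \<le> K2" and K3: "0 < K3" and
    weight: "\<And>(G :: 'a \<Rightarrow> real) t F.
      \<lbrakk>G \<in> borel_measurable lebesgue; \<And>x. 0 \<le> G x; 0 < t;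
       \<And>l. 1 \<le> l \<Longrightarrow> emeasure lebesgue {x. l < G x} \<le> ennreal (t * l powr - a);
       \<And>l. 0 < l \<Longrightarrow> l \<le> 1 \<Longrightarrow> emeasure lebesgue {x. l < G x} \<le> ennreal (t * l powr - b);
       F \<in> sets lebesgue; ennreal t \<le> emeasure lebesgue F; emeasure lebesgue F < \<infinity>\<rbrakk> \<Longrightarrow>
      \<exists>u\<in>Ap p0. u \<in> borel_measurable lebesgue \<and> Ap_const p0 u \<le> ennreal K0
        \<and> (\<integral>\<^sup>+x. ennreal (G x powr p0) * ennreal (u x) \<partial>lebesgue) \<le> ennreal K2 * emeasure lebesgue F
        \<and> ennreal K3 * emeasure lebesgue F \<le> (\<integral>\<^sup>+x\<in>F. ennreal (u x) \<partial>lebesgue)"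
    using exists_extrapolation_weight[OF ab p0, where 'a = 'a] by blast
  obtain M where M: "0 \<le> M" "\<And>x. 0 \<le> x \<Longrightarrow> x \<le> K0 \<Longrightarrow> \<phi> x \<le> M"
  proof -
    have "bdd_above (\<phi> ` {0<..<K0 + 1})" using lb K0 by (auto simp: locally_bounded_def)
    then obtain M where M: "\<And>x. 0 < x \<Longrightarrow> x < K0 + 1 \<Longrightarrow> \<phi> x \<le> M" by (force simp: bdd_above_def)
    show thesis
    \<comment> \<open>\<open>locally_bounded\<close> says nothing about the value at 0, which
      \<open>enn2real\<close> of the A_p constant is not shown to avoid; the outer maximum makes the
      bound nonnegative.\<close>
    proof (rule that[of "max 0 (max M (\<phi> 0))"])
      fix x assume "0 \<le> x" "x \<le> K0"
      then show "\<phi> x \<le> max 0 (max M (\<phi> 0))" using M[of x] by (cases "x = 0") auto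
    qed simp
  qed
  \<comment> \<open>For a set F of measure m the weak type inequality becomes K (K3 m)^(1/p0) <= M
    (K2 m)^(1/p0) after division by B. The summand 1 makes this fail.\<close>
  define K where "K = M * (K2 / K3) powr (1 / p0) + 1"
  have K: "0 < K" using M by (simp add: K_def add_nonneg_pos)
  show thesis
  proof (rule that[OF K])
    fix f :: "'a \<Rightarrow> 'k" and t B :: real
    assume f[measurable]: "f \<in> borel_measurable lebesgue" and t: "0 < t" and B: "0 < B"
      and hi: "\<And>l. 1 \<le> l \<Longrightarrow> emeasure lebesgue {x. l * B < norm (f x)} \<le> ennreal (t * l powr - a)"
      and lo: "\<And>l. 0 < l \<Longrightarrow> l \<le> 1 \<Longrightarrow> emeasure lebesgue {x. l * B < norm (f x)} \<le> ennreal (t * l powr - b)"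
    define G where "G x = norm (f x) / B" for x
    have [measurable]: "G \<in> borel_measurable lebesgue" unfolding G_def by measurable
    have Gl: "{x. l < G x} = {x. l * B < norm (f x)}" for l
      using B by (auto simp: G_def pos_less_divide_eq)
    have G0: "0 \<le> G x" for x using B by (simp add: G_def)
    have hi': "emeasure lebesgue {x. l < G x} \<le> ennreal (t * l powr - a)" if "1 \<le> l" for l
      unfolding Gl by (rule hi[OF that])
    have lo': "emeasure lebesgue {x. l < G x} \<le> ennreal (t * l powr - b)" if "0 < l" "l \<le> 1" for l
      unfolding Gl by (rule lo[OF that])
    \<comment> \<open>Even measurability of T f is available only through a weight for which f has
      finite norm. Hence F is left arbitrary: a ball serves for measurability, a part of the level
      set for the contradiction.\<close>
    have main: "T f \<in> borel_measurable lebesgue \<and> (\<exists>u. weak_Lp_norm p0 u (T f) \<le> ennreal (M * (B * (K2 * measure lebesgue F) powr (1 / p0)))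
        \<and> ennreal (K3 * measure lebesgue F) \<le> (\<integral>\<^sup>+x\<in>F. ennreal (u x) \<partial>lebesgue))"
      if F: "F \<in> sets lebesgue" "ennreal t \<le> emeasure lebesgue F" "emeasure lebesgue F < \<infinity>" for F
    proof -
      define m where "m = measure lebesgue F"
      have m: "emeasure lebesgue F = ennreal m" "0 \<le> m"
        using emeasure_eq_ennreal_measure[of lebesgue F] F(3) by (auto simp: m_def)
      obtain u where [measurable]: "u \<in> borel_measurable lebesgue"
        and u: "u \<in> Ap p0" "Ap_const p0 u \<le> ennreal K0"
        "(\<integral>\<^sup>+x. ennreal (G x powr p0) * ennreal (u x) \<partial>lebesgue) \<le> ennreal K2 * emeasure lebesgue F"
        "ennreal K3 * emeasure lebesgue F \<le> (\<integral>\<^sup>+x\<in>F. ennreal (u x) \<partial>lebesgue)"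
        by (rule bexE[OF weight[OF \<open>G \<in> borel_measurable lebesgue\<close> G0 t hi' lo' F]]) auto
      have "(\<integral>\<^sup>+x. ennreal (norm (f x) powr p0) * ennreal (u x) \<partial>lebesgue)
          = (\<integral>\<^sup>+x. ennreal (B powr p0) * (ennreal (G x powr p0) * ennreal (u x)) \<partial>lebesgue)"
      proof (rule nn_integral_cong)
        fix x
        have "norm (f x) powr p0 = B powr p0 * G x powr p0"
          using B by (simp add: G_def powr_mult[symmetric])
        then show "ennreal (norm (f x) powr p0) * ennreal (u x) = ennreal (B powr p0) * (ennreal (G x powr p0) * ennreal (u x))"
          by (simp add: ennreal_mult mult.assoc)
      qed
      also have "\<dots> = ennreal (B powr p0) * (\<integral>\<^sup>+x. ennreal (G x powr p0) * ennreal (u x) \<partial>lebesgue)"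
        by (rule nn_integral_cmult) measurable
      also have "\<dots> \<le> ennreal (B powr p0) * (ennreal K2 * emeasure lebesgue F)"
        by (intro mult_left_mono u) simp
      also have "\<dots> = ennreal ((B * (K2 * m) powr (1 / p0)) powr p0)"
        using m K2 B p0 by (simp add: ennreal_mult[symmetric] powr_mult powr_powr)
      finally have N: "Lp_norm p0 u f \<le> ennreal (B * (K2 * m) powr (1 / p0))"
        unfolding Lp_norm_def using B p0 by (subst epowr_le_iff_root) auto
      then have "Lp_norm p0 u f < \<infinity>" by (rule le_less_trans) simp
      then have Tf: "T f \<in> borel_measurable lebesgue"
        "weak_Lp_norm p0 u (T f) \<le> ennreal (\<phi> (enn2real (Ap_const p0 u))) * Lp_norm p0 u f"
        using T[OF u(1)] f by (auto simp: bounded_op_def)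
      have "enn2real (Ap_const p0 u) \<le> K0"
        using enn2real_mono[OF u(2)] K0 by simp
      then have "\<phi> (enn2real (Ap_const p0 u)) \<le> M" using M by simp
      then have "ennreal (\<phi> (enn2real (Ap_const p0 u))) * Lp_norm p0 u f \<le> ennreal M * ennreal (B * (K2 * m) powr (1 / p0))"
        by (intro mult_mono N ennreal_leI) auto
      then have "weak_Lp_norm p0 u (T f) \<le> ennreal (M * (B * (K2 * m) powr (1 / p0)))"
        using Tf(2) M B by (auto simp: ennreal_mult[symmetric] intro: order_trans)
      moreover have "ennreal (K3 * m) \<le> (\<integral>\<^sup>+x\<in>F. ennreal (u x) \<partial>lebesgue)"
        using u(4) K3 m by (simp add: ennreal_mult)
      ultimately show ?thesis using Tf(1) unfolding m_def by blast
    qed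
    have Tm: "T f \<in> borel_measurable lebesgue"
    proof -
      \<comment> \<open>A ball of measure at least t is wanted; r >= 1 ensures r^n >= r.\<close>
      define r where "r = max 1 (t / unit_ball_vol (real DIM('a)))"
      have "t / unit_ball_vol (real DIM('a)) \<le> r ^ 1" by (simp add: r_def)
      also have "r ^ 1 \<le> r ^ DIM('a)"
        by (intro power_increasing) (auto simp: r_def Suc_le_eq)
      finally have "t \<le> unit_ball_vol (real DIM('a)) * r ^ DIM('a)"
        by (simp add: pos_divide_le_eq mult.commute)
      then have "ennreal t \<le> emeasure lebesgue (ball (0::'a) r)"
        by (subst emeasure_lebesgue_ball) (auto simp: r_def intro: ennreal_leI)
      moreover have "emeasure lebesgue (ball (0::'a) r) < \<infinity>"
        by (subst emeasure_lebesgue_ball) (auto simp: r_def)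
      ultimately show ?thesis using main[of "ball 0 r"] by simp
    qed
    define E where "E = {x. K * B < norm (T f x)}"
    have Em: "E \<in> sets lebesgue"
      unfolding E_def using Tm by (intro sets_lebesgue_greater) measurable
    have "emeasure lebesgue E \<le> ennreal t"
    proof (rule ccontr)
      assume "\<not> emeasure lebesgue E \<le> ennreal t"
      then have less: "ennreal t < emeasure lebesgue E" by simp
      have bm: "ball (0::'a) r \<in> sets lebesgue" for r by simp
      \<comment> \<open>\<open>E\<close> may have infinite measure. Continuity from below yields a
        bounded part whose measure still exceeds t.\<close>
      have "(\<Union>i. E \<inter> ball 0 (real i)) = E"
      proof (rule set_eqI)
        fix x :: 'a
        obtain i :: nat where "norm x < real i" using reals_Archimedean2 by blast
        then show "x \<in> (\<Union>i. E \<inter> ball 0 (real i)) \<longleftrightarrow> x \<in> E" by auto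
      qed
      moreover have "(SUP i. emeasure lebesgue (E \<inter> ball 0 (real i))) = emeasure lebesgue (\<Union>i. E \<inter> ball 0 (real i))"
        using Em bm by (intro SUP_emeasure_incseq) (auto simp: incseq_def)
      ultimately obtain i where i: "ennreal t < emeasure lebesgue (E \<inter> ball 0 (real i))"
        using less by (metis (no_types, lifting) less_SUP_iff)
      define F where "F = E \<inter> ball 0 (real i)"
      have F: "F \<in> sets lebesgue" "ennreal t \<le> emeasure lebesgue F" "F \<subseteq> E"
        using Em bm i by (auto simp: F_def)
      have "emeasure lebesgue F \<le> emeasure lebesgue (ball (0::'a) (real i))"
        using Em bm by (intro emeasure_mono) (auto simp: F_def)
      also have "\<dots> < \<infinity>" by (subst emeasure_lebesgue_ball) auto
      finally have Ff: "emeasure lebesgue F < \<infinity>" .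
      define m where "m = measure lebesgue F"
      have m: "emeasure lebesgue F = ennreal m"
        using emeasure_eq_ennreal_measure[of lebesgue F] Ff by (auto simp: m_def)
      have m0: "0 < m" using F(2) t unfolding m by (simp add: ennreal_le_iff2)
      obtain u where u: "weak_Lp_norm p0 u (T f) \<le> ennreal (M * (B * (K2 * m) powr (1 / p0)))"
        "ennreal (K3 * m) \<le> (\<integral>\<^sup>+x\<in>F. ennreal (u x) \<partial>lebesgue)"
        using main[OF F(1,2) Ff] unfolding m_def by blast
      have "ennreal (K3 * m) \<le> (\<integral>\<^sup>+x\<in>E. ennreal (u x) \<partial>lebesgue)"
        using F(3) by (intro order_trans[OF u(2)] nn_integral_mono) (auto split: split_indicator)
      then have "ennreal (K3 * m) epowr (1 / p0) \<le> (\<integral>\<^sup>+x\<in>E. ennreal (u x) \<partial>lebesgue) epowr (1 / p0)"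
        using p0 by (intro epowr_mono) auto
      then have "ennreal (K * B) * ennreal ((K3 * m) powr (1 / p0))
          \<le> ennreal (K * B) * (\<integral>\<^sup>+x\<in>E. ennreal (u x) \<partial>lebesgue) epowr (1 / p0)"
        using K3 m0 by (intro mult_left_mono) (auto simp: epowr_ennreal)
      also have "\<dots> \<le> weak_Lp_norm p0 u (T f)"
        unfolding weak_Lp_norm_def E_def using K B by (intro SUP_upper2[of "K * B"]) auto
      also note u(1)
      finally have "K * B * (K3 * m) powr (1 / p0) \<le> M * (B * (K2 * m) powr (1 / p0))"
        using K B M by (simp add: ennreal_mult[symmetric])
      moreover have "(K2 * m) powr (1 / p0) = (K2 / K3) powr (1 / p0) * (K3 * m) powr (1 / p0)"
        using K2 K3 m0 by (simp add: powr_mult[symmetric])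
      ultimately have "K * (B * (K3 * m) powr (1 / p0)) \<le> (M * (K2 / K3) powr (1 / p0)) * (B * (K3 * m) powr (1 / p0))"
        by (simp add: mult_ac)
      then have "K \<le> M * (K2 / K3) powr (1 / p0)"
        using B K3 m0 by (subst (asm) mult_le_cancel_right_pos) auto
      then show False by (simp add: K_def)
    qed
    then show "T f \<in> borel_measurable lebesgue \<and> emeasure lebesgue {x. K * B < norm (T f x)} \<le> ennreal t"
      using Tm by (simp add: E_def)
  qed
qed

section \<open>The half-line\<close>

text \<open>\<open>w\<close> is cut off to the positive half-line because its other values are
  arbitrary. Increments of \<open>prim w\<close> become measures of intervals, so additivity of
  measures can be used for them.\<close>

definition half_line_measure :: "(real \<Rightarrow> real) \<Rightarrow> real measure" where
  "half_line_measure w = density lebesgue (\<lambda>x. ennreal (indicator {0<..} x * w x))"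

lemma sets_half_line_measure [simp, measurable_cong]: "sets (half_line_measure w) = sets lebesgue"
  by (simp add: half_line_measure_def)

text \<open>\<open>half_line_weight\<close> speaks only of the intervals (0,t). The truncations to
  (0,n+1) agree with the function at each point from some n on.\<close>

lemma half_line_weight_measurable:
  assumes "half_line_weight w"
  shows "(\<lambda>x. indicator {0<..} x * w x) \<in> borel_measurable lebesgue"
proof (rule borel_measurable_LIMSEQ_real)
  fix x :: real
  obtain N :: nat where N: "x < real N" using reals_Archimedean2 by blast
  have "eventually (\<lambda>n. indicator {0<..<real (Suc n)} x * w x = indicator {0<..} x * w x) sequentially"
    using eventually_ge_at_top[of N]
  proof eventually_elim
    case (elim n)
    then show ?case using N by (auto split: split_indicator)
  qed
  then show "(\<lambda>n. indicator {0<..<real (Suc n)} x * w x) \<longlonglongrightarrow> indicator {0<..} x * w x"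
    by (rule tendsto_eventually)
next
  fix n :: nat
  have "set_integrable lebesgue {0<..<real (Suc n)} w"
    using assms by (simp add: half_line_weight_def)
  then show "(\<lambda>x. indicator {0<..<real (Suc n)} x * w x) \<in> borel_measurable lebesgue"
    unfolding set_integrable_def by (auto dest: borel_measurable_integrable)
qed

lemma sets_lebesgue_interval [measurable, simp]:
  fixes s t :: real
  shows "{s<..<t} \<in> sets lebesgue" "{s..<t} \<in> sets lebesgue" "{s<..} \<in> sets lebesgue" "{s..} \<in> sets lebesgue"
  by (auto intro!: sets_completionI_sets)

lemma emeasure_half_line_measure:
  assumes w: "half_line_weight w" and A: "A \<in> sets lebesgue" "A \<subseteq> {0<..}"
  shows "emeasure (half_line_measure w) A = (\<integral>\<^sup>+x\<in>A. ennreal (w x) \<partial>lebesgue)"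
  using half_line_weight_measurable[OF w] A unfolding half_line_measure_def
  by (subst emeasure_density) (auto intro!: nn_integral_cong split: split_indicator)

lemma emeasure_half_line_prim:
  assumes w: "half_line_weight w" and t: "0 < t"
  shows "emeasure (half_line_measure w) {0<..<t} = ennreal (prim w t)"
proof -
  have "(\<integral>\<^sup>+x\<in>{0<..<t}. ennreal (w x) \<partial>lebesgue) = (\<integral>\<^sup>+x. ennreal (indicator {0<..<t} x *\<^sub>R w x) \<partial>lebesgue)"
    by (intro nn_integral_cong) (auto split: split_indicator)
  also have "\<dots> = ennreal (prim w t)"
    unfolding prim_def set_lebesgue_integral_def
    using w t by (intro nn_integral_eq_integral)
      (auto simp: half_line_weight_def set_integrable_def split: split_indicator)
  finally show ?thesis
    using t by (subst emeasure_half_line_measure[OF w]) auto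
qed

lemma prim_nonneg:
  assumes "half_line_weight w"
  shows "0 \<le> prim w t"
  unfolding prim_def set_lebesgue_integral_def
  using assms by (intro integral_nonneg_AE) (auto simp: half_line_weight_def split: split_indicator)

lemma emeasure_half_line_split:
  assumes w: "half_line_weight w" and st: "0 < s" "s \<le> t"
  shows "ennreal (prim w s) + emeasure (half_line_measure w) {s..<t} = ennreal (prim w t)"
proof -
  have "{0<..<t} = {0<..<s} \<union> {s..<t}" using st by auto
  then have "emeasure (half_line_measure w) {0<..<t}
      = emeasure (half_line_measure w) {0<..<s} + emeasure (half_line_measure w) {s..<t}"
    by (simp only:) (rule plus_emeasure[symmetric]; auto)
  then show ?thesis using st by (simp add: emeasure_half_line_prim[OF w])
qed

lemma emeasure_half_line_diff:
  assumes w: "half_line_weight w" and st: "0 < s" "s \<le> t"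
  shows "emeasure (half_line_measure w) {s..<t} = ennreal (prim w t - prim w s)"
proof -
  have "emeasure (half_line_measure w) {s..<t} = ennreal (prim w t) - ennreal (prim w s)"
    unfolding emeasure_half_line_split[OF assms, symmetric] by (simp add: ennreal_add_diff_cancel_left)
  then show ?thesis using prim_nonneg[OF w] by (simp add: ennreal_minus)
qed

lemma prim_mono:
  assumes w: "half_line_weight w" and st: "0 < s" "s \<le> t"
  shows "prim w s \<le> prim w t"
  using emeasure_half_line_split[OF assms] prim_nonneg[OF w]
  by (metis ennreal_le_iff le_iff_add)

lemma prim_unbounded:
  assumes w: "half_line_weight w" and inf: "(\<integral>\<^sup>+t\<in>{0<..}. ennreal (w t) \<partial>lebesgue) = \<infinity>"
  shows "\<exists>n. M < prim w (real (Suc n))"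
proof (rule ccontr)
  assume "\<not> ?thesis"
  then have M: "prim w (real (Suc n)) \<le> M" for n by (simp add: not_less)
  have U: "(\<Union>n. {0<..<real (Suc n)}) = {0<..}"
  proof (rule set_eqI)
    fix x :: real
    obtain N :: nat where "x < real N" using reals_Archimedean2 by blast
    then have "x < real (Suc N)" by simp
    then show "x \<in> (\<Union>n. {0<..<real (Suc n)}) \<longleftrightarrow> x \<in> {0<..}" by auto
  qed
  have "(SUP n. emeasure (half_line_measure w) {0<..<real (Suc n)}) = emeasure (half_line_measure w) {0<..}"
    unfolding U[symmetric] by (intro SUP_emeasure_incseq) (auto simp: incseq_def)
  also have "\<dots> = \<infinity>"
    using inf by (subst emeasure_half_line_measure[OF w]) auto
  finally have "(SUP n. emeasure (half_line_measure w) {0<..<real (Suc n)}) = \<infinity>" .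
  moreover have "(SUP n. emeasure (half_line_measure w) {0<..<real (Suc n)}) \<le> ennreal M"
    by (intro SUP_least) (simp only: emeasure_half_line_prim[OF w of_nat_0_less_iff[THEN iffD2, OF zero_less_Suc]] M ennreal_leI)
  ultimately show False by (simp only: infinity_ennreal_def top_unique ennreal_neq_top)
qed

section \<open>Quasi-monotonicity of W^(1/p) under condition (a)\<close>

text \<open>The sum \<open>g + H\<close> is comparable to \<open>g\<close> and shrinks by a fixed factor when the argument doubles.
  With \<open>g t = W t / t powr p\<close> and \<open>H x\<close> the integral of \<open>w t / t powr p\<close> over \<open>t > x\<close>, this is the
  self-improvement of the \<open>Bp\<close> condition.\<close>

lemma power_decay:
  fixes g H :: "real \<Rightarrow> real"
  assumes p: "0 < p" and C: "1 \<le> C" and g: "\<And>x. 0 < x \<Longrightarrow> 0 \<le> g x"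
    and H: "\<And>x. 0 < x \<Longrightarrow> 0 \<le> H x" "\<And>x. 0 < x \<Longrightarrow> H x \<le> C * g x"
    and step: "\<And>x t. 0 < x \<Longrightarrow> x \<le> t \<Longrightarrow> g t \<le> (x / t) powr p * g x + H x - H t"
  obtains \<epsilon> A where "0 < \<epsilon>" "\<epsilon> < p" "0 < A" "\<And>x t. 0 < x \<Longrightarrow> x < t \<Longrightarrow> g t \<le> A * (x / t) powr \<epsilon> * g x"
proof -
  \<comment> \<open>With V = g + H, \<open>step\<close> at t = 2x gives V(2x) <= V(x) - (1 - 2^-p)
    g(x), and V(x) <= (C+1) g(x) turns the loss into a fixed fraction of V(x). Since rho > 2^-p, the
    resulting exponent is less than p.\<close>
  define \<rho> where "\<rho> = 1 - (1 - 2 powr - p) / (C + 1)"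
  have p2: "0 < 2 powr - p" "2 powr - p < 1" using powr_less_mono[of "- p" 0 2] p by auto
  have "(1 - 2 powr - p) / (C + 1) < (1 - 2 powr - p) / 1"
    using p2 C by (intro divide_strict_left_mono) auto
  then have \<rho>p: "2 powr - p < \<rho>" by (simp add: \<rho>_def)
  have "0 < (1 - 2 powr - p) / (C + 1)" using p2 C by (intro divide_pos_pos) auto
  then have \<rho>: "0 < \<rho>" "\<rho> < 1" using \<rho>p p2(1) by (linarith, simp only: \<rho>_def)
  define \<epsilon> where "\<epsilon> = - log 2 \<rho>"
  have \<rho>\<epsilon>: "\<rho> = 2 powr - \<epsilon>" using \<rho> by (simp add: \<epsilon>_def)
  have "0 < \<epsilon>" using \<rho> by (simp add: \<epsilon>_def)
  moreover have "\<epsilon> < p" using \<rho>p unfolding \<rho>\<epsilon> by simp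
  moreover
  define V where "V x = g x + H x" for x
  have gV: "g x \<le> V x" "V x \<le> (C + 1) * g x" if "0 < x" for x
    using H[OF that] by (auto simp: V_def algebra_simps)
  have V2: "V (2 * x) \<le> \<rho> * V x" if x: "0 < x" for x
  proof -
    have "V (2 * x) \<le> V x - (1 - 2 powr - p) * g x"
      using step[of x "2 * x"] x by (simp add: V_def powr_divide powr_minus_divide algebra_simps)
    moreover have "(1 - 2 powr - p) / (C + 1) * V x \<le> (1 - 2 powr - p) / (C + 1) * ((C + 1) * g x)"
      using gV[OF x] p2 C by (intro mult_left_mono) auto
    moreover have "(1 - 2 powr - p) / (C + 1) * ((C + 1) * g x) = (1 - 2 powr - p) * g x"
      using C by simp
    moreover have "\<rho> * V x = V x - (1 - 2 powr - p) / (C + 1) * V x"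
      by (simp only: \<rho>_def left_diff_distrib mult_1)
    ultimately show ?thesis by linarith
  qed
  have Vk: "V (2 ^ k * x) \<le> \<rho> ^ k * V x" if x: "0 < x" for x k
  proof (induction k)
    case (Suc k)
    have "V (2 ^ Suc k * x) \<le> \<rho> * V (2 ^ k * x)"
      using V2[of "2 ^ k * x"] x by (simp add: mult.assoc)
    also have "\<dots> \<le> \<rho> * (\<rho> ^ k * V x)" using Suc \<rho> by (intro mult_left_mono) auto
    finally show ?case by (simp add: mult.assoc)
  qed simp
  \<comment> \<open>A crude comparison that carries the bound from the dyadic point 2^k x to
    t.\<close>
  have gC: "g t \<le> (C + 1) * g x" if "0 < x" "x \<le> t" for x t
  proof -
    have "(x / t) powr p * g x \<le> 1 * g x"
      using that p g[of x] by (intro mult_right_mono powr_le1) auto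
    then show ?thesis using step[OF that] H(1)[of t] H(2)[of x] that by (simp add: algebra_simps)
  qed
  have "g t \<le> ((C + 1) * (C + 1) * 2 powr \<epsilon>) * (x / t) powr \<epsilon> * g x" if x: "0 < x" and xt: "x < t" for x t
  proof -
    define k where "k = nat \<lfloor>log 2 (t / x)\<rfloor>"
    have "0 < log 2 (t / x)" using x xt by simp
    then have k: "real k \<le> log 2 (t / x)" "log 2 (t / x) \<le> real k + 1"
      unfolding k_def by linarith+
    have "2 powr real k \<le> 2 powr log 2 (t / x)" "2 powr log 2 (t / x) \<le> 2 powr (real k + 1)"
      using k by auto
    then have k2: "2 ^ k * x \<le> t" "t / x \<le> 2 * 2 ^ k"
      using x xt by (simp_all add: powr_realpow powr_add pos_le_divide_eq)
    have "g t \<le> (C + 1) * g (2 ^ k * x)" using k2 x by (intro gC) auto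
    also have "\<dots> \<le> (C + 1) * (\<rho> ^ k * V x)"
      using C x gV(1)[of "2 ^ k * x"] Vk[OF x, of k] by (intro mult_left_mono) auto
    also have "\<dots> \<le> (C + 1) * (\<rho> ^ k * ((C + 1) * g x))"
      using C x gV(2)[OF x] \<rho> by (intro mult_left_mono) auto
    also have "\<rho> ^ k \<le> 2 powr \<epsilon> * (x / t) powr \<epsilon>"
    proof -
      have "\<rho> ^ k = (2 powr real k) powr - \<epsilon>"
        unfolding \<rho>\<epsilon> by (simp add: powr_power powr_powr mult.commute)
      also have "\<dots> = (2 ^ k) powr - \<epsilon>" by (simp add: powr_realpow)
      also have "\<dots> \<le> (t / x / 2) powr - \<epsilon>"
        using k2 x xt \<open>0 < \<epsilon>\<close> by (intro powr_mono2') auto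
      also have "\<dots> = 2 powr \<epsilon> * (x / t) powr \<epsilon>"
        using x xt by (simp add: powr_divide powr_minus_divide powr_mult)
      finally show ?thesis .
    qed
    then have "(C + 1) * (\<rho> ^ k * ((C + 1) * g x)) \<le> (C + 1) * (2 powr \<epsilon> * (x / t) powr \<epsilon> * ((C + 1) * g x))"
      using C g[OF x] by (intro mult_left_mono mult_right_mono) auto
    finally show ?thesis by (simp add: mult_ac)
  qed
  ultimately show thesis using that[of \<epsilon> "(C + 1) * (C + 1) * 2 powr \<epsilon>"] C by simp
qed

lemma AE_lebesgue_neq: "AE y in lebesgue. y \<noteq> (x::real)"
  using AE_completion[OF AE_lborel_singleton[of x]] .

text \<open>The decay exponent epsilon of W(t) / t^p supplied by \<open>power_decay\<close> becomes
  delta = 1 - epsilon/p, which is positive because epsilon < p.\<close>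

lemma Bp_quasi_decreasing:
  assumes w: "half_line_weight w" and p: "0 < p" and Bp: "w \<in> Bp p"
    and inf: "(\<integral>\<^sup>+t\<in>{0<..}. ennreal (w t) \<partial>lebesgue) = \<infinity>"
  shows "\<exists>\<delta>. 0 < \<delta> \<and> \<delta> < 1 \<and> quasi_decreasing (\<lambda>t. prim w t powr (1 / p) / t powr \<delta>)"
proof -
  define w' where "w' x = indicator {0<..} x * w x" for x :: real
  have [measurable]: "w' \<in> borel_measurable lebesgue"
    unfolding w'_def by (rule half_line_weight_measurable[OF w])
  have w'0: "0 \<le> w' x" for x
    using w by (auto simp: w'_def half_line_weight_def split: split_indicator)
  obtain C0 where C0: "\<And>r. 0 < r \<Longrightarrow>
      ennreal (r powr p) * (\<integral>\<^sup>+t\<in>{r<..}. ennreal (w t / t powr p) \<partial>lebesgue) \<le> ennreal (C0 * prim w r)"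
    using Bp by (auto simp: Bp_def)
  define C where "C = max 1 C0"
  define g where "g x = prim w x / x powr p" for x
  define J where "J A = (\<integral>\<^sup>+y\<in>A. ennreal (w' y / y powr p) \<partial>lebesgue)" for A
  have [measurable]: "(\<lambda>y::real. y powr p) \<in> borel_measurable lebesgue"
    by (rule measurable_completion) simp
  have J_le: "J {x..} \<le> ennreal (C * g x)" if x: "0 < x" for x
  proof -
    \<comment> \<open>The open half-line in \<open>Bp\<close> differs from the closed one by a null
      set; the closed ones split exactly into {x..<t} and {t..}.\<close>
    have "J {x..} = (\<integral>\<^sup>+t\<in>{x<..}. ennreal (w t / t powr p) \<partial>lebesgue)"
      unfolding J_def using AE_lebesgue_neq[of x]
      by (intro nn_integral_cong_AE, eventually_elim)
        (use x in \<open>auto simp: w'_def split: split_indicator\<close>)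
    then have "ennreal (x powr p) * J {x..} \<le> ennreal (C0 * prim w x)" using C0[OF x] by simp
    also have "\<dots> \<le> ennreal (C * prim w x)"
      using prim_nonneg[OF w] by (intro ennreal_leI mult_right_mono) (auto simp: C_def)
    also have "\<dots> = ennreal (x powr p) * ennreal (C * g x)"
      using x prim_nonneg[OF w, of x] by (simp add: ennreal_mult[symmetric] g_def C_def)
    finally show ?thesis using x by (subst (asm) ennreal_mult_le_mult_iff) auto
  qed
  define H where "H x = enn2real (J {x..})" for x
  have JH: "J {x..} = ennreal (H x)" if "0 < x" for x
    using le_less_trans[OF J_le[OF that]] by (simp add: H_def)
  have g0: "0 \<le> g x" for x using prim_nonneg[OF w] by (simp add: g_def)
  have H0: "0 \<le> H x" for x by (simp add: H_def)
  have HC: "H x \<le> C * g x" if "0 < x" for x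
    using J_le[OF that] g0[of x] unfolding JH[OF that] by (simp add: C_def)
  \<comment> \<open>On [x,t) the factor (t/y)^p is at least 1, so W(t) - W(x) <= t^p (H(x) -
    H(t)).\<close>
  have step: "g t \<le> (x / t) powr p * g x + H x - H t" if x: "0 < x" and xt: "x \<le> t" for x t
  proof -
    have "J {x..} = J {x..<t} + J {t..}"
      unfolding J_def using xt
      by (subst nn_integral_add[symmetric], measurable)
        (auto intro!: nn_integral_cong split: split_indicator)
    then have Jd: "ennreal (H x) = J {x..<t} + ennreal (H t)" using JH x xt by simp
    have "ennreal (prim w t - prim w x) = (\<integral>\<^sup>+y\<in>{x..<t}. ennreal (w y) \<partial>lebesgue)"
      using x xt by (subst emeasure_half_line_diff[OF w x xt, symmetric], subst emeasure_half_line_measure[OF w]) auto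
    also have "\<dots> \<le> (\<integral>\<^sup>+y. ennreal (t powr p) * (ennreal (w' y / y powr p) * indicator {x..<t} y) \<partial>lebesgue)"
    proof (rule nn_integral_mono)
      fix y
      show "ennreal (w y) * indicator {x..<t} y \<le> ennreal (t powr p) * (ennreal (w' y / y powr p) * indicator {x..<t} y)"
      proof (cases "y \<in> {x..<t}")
        case True
        then have y: "0 < y" "y < t" using x by auto
        have "w' y * 1 \<le> w' y * (t / y) powr p"
          using y p w'0[of y] by (intro mult_left_mono ge_one_powr_ge_zero) auto
        then have "w y \<le> t powr p * (w' y / y powr p)"
          using y by (simp add: w'_def powr_divide mult.commute)
        then show ?thesis using True w'0[of y] by (simp add: ennreal_mult[symmetric] ennreal_leI)
      qed simp
    qed
    also have "\<dots> = ennreal (t powr p) * J {x..<t}"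
      unfolding J_def by (rule nn_integral_cmult) measurable
    finally have "ennreal (prim w t - prim w x) + ennreal (t powr p) * ennreal (H t) \<le> ennreal (t powr p) * ennreal (H x)"
      unfolding Jd distrib_left by (rule add_right_mono)
    then have "prim w t - prim w x + t powr p * H t \<le> t powr p * H x"
      using prim_mono[OF w x xt] H0 by (simp add: ennreal_mult[symmetric] ennreal_plus[symmetric] del: ennreal_plus)
    then have "(prim w t - prim w x + t powr p * H t) / t powr p \<le> t powr p * H x / t powr p"
      by (rule divide_right_mono) simp
    then show ?thesis using x xt by (simp add: g_def powr_divide add_divide_distrib diff_divide_distrib)
  qed
  \<comment> \<open>If W(s) = 0, then g(s) and H(s) vanish, and \<open>step\<close> forces W = 0
    beyond s, contrary to W(infinity) = infinity.\<close>
  have pos: "0 < prim w s" if s: "0 < s" for s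
  proof (rule ccontr)
    assume "\<not> 0 < prim w s"
    then have z: "prim w s = 0" using prim_nonneg[OF w, of s] by simp
    obtain n where n: "0 < prim w (real (Suc n))" using prim_unbounded[OF w inf] by blast
    show False
    proof (cases "real (Suc n) \<le> s")
      case True
      then show False using prim_mono[OF w _ True] n z by simp
    next
      case False
      then have "g (real (Suc n)) \<le> 0"
        using step[of s "real (Suc n)"] s HC[OF s] H0[of "real (Suc n)"] z by (simp add: g_def)
      then show False using n by (simp add: g_def divide_le_0_iff not_le[symmetric])
    qed
  qed
  obtain \<epsilon> A where \<epsilon>: "0 < \<epsilon>" "\<epsilon> < p" and A: "0 < A"
    and decay: "\<And>x t. 0 < x \<Longrightarrow> x < t \<Longrightarrow> g t \<le> A * (x / t) powr \<epsilon> * g x"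
    by (rule power_decay[of p C g H]) (use p g0 H0 HC step in \<open>auto simp: C_def\<close>)
  define \<delta> where "\<delta> = 1 - \<epsilon> / p"
  have h: "prim w t powr (1 / p) / t powr \<delta> = (g t * t powr \<epsilon>) powr (1 / p)" if "0 < t" for t
  proof -
    have "g t * t powr \<epsilon> = prim w t / t powr (p - \<epsilon>)"
      using that by (simp add: g_def powr_diff)
    also have "\<dots> powr (1 / p) = prim w t powr (1 / p) / t powr \<delta>"
      using p that by (simp add: powr_divide powr_powr \<delta>_def diff_divide_distrib)
    finally show ?thesis by simp
  qed
  have "quasi_decreasing (\<lambda>t. prim w t powr (1 / p) / t powr \<delta>)"
    unfolding quasi_decreasing_def
  proof (intro conjI exI allI impI)
    fix t :: real assume "0 < t"
    then show "0 < prim w t powr (1 / p) / t powr \<delta>" using pos[of t] by simp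
  next
    fix s t :: real assume st: "0 < s \<and> s < t"
    have "g t * t powr \<epsilon> \<le> (A * (s / t) powr \<epsilon> * g s) * t powr \<epsilon>"
      using decay st by (intro mult_right_mono) auto
    also have "\<dots> = A * (g s * s powr \<epsilon>)" using st by (simp add: powr_divide)
    finally have "(g t * t powr \<epsilon>) powr (1 / p) \<le> (A * (g s * s powr \<epsilon>)) powr (1 / p)"
      using p g0 by (intro powr_mono2) auto
    also have "\<dots> = A powr (1 / p) * (g s * s powr \<epsilon>) powr (1 / p)"
      by (rule powr_mult)
    finally show "prim w t powr (1 / p) / t powr \<delta> \<le> A powr (1 / p) * (prim w s powr (1 / p) / s powr \<delta>)"
      using h st by simp
  qed
  moreover have "0 < \<delta>" "\<delta> < 1" using \<epsilon> p by (auto simp: \<delta>_def)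
  ultimately show ?thesis by blast
qed

text \<open>Quasi-decrease makes W doubling with a constant D, so y can be taken among the points
  2^k x without an intermediate value argument: minimality of k gives W(y) <= 2 D W(x). With c =
  x^(1-mu) / (2 D W(x)), the integrand on [x,y) is at least c^p' w, and the mass of w there is at
  least W(x). The left side of the hypothesis is therefore at least c W(x)^(1/p') = x^(1-mu) / (2 D
  W(x)^(1/p)).\<close>

lemma integral_condition_quasi_increasing:
  assumes w: "half_line_weight w" and p: "1 < p" and \<mu>: "0 < \<mu>" "\<mu> < 1"
    and qd: "quasi_decreasing (\<lambda>t. prim w t powr (1 / p) / t powr \<delta>)"
    and inf: "(\<integral>\<^sup>+t\<in>{0<..}. ennreal (w t) \<partial>lebesgue) = \<infinity>"
    and cond: "\<And>s. 0 < s \<Longrightarrow>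
      (\<integral>\<^sup>+t\<in>{s<..}. ennreal ((t powr (1 - \<mu>) / prim w t) powr conj_exp p * w t) \<partial>lebesgue) epowr (1 / conj_exp p)
        \<le> ennreal (C * (s powr (1 - \<mu>) / prim w s powr (1 / p)))"
  shows "quasi_increasing (\<lambda>t. prim w t powr (1 / p) / t powr (1 - \<mu>))"
proof -
  have pos: "0 < prim w t" if "0 < t" for t
  proof -
    have "0 < prim w t powr (1 / p) / t powr \<delta>" using qd that by (auto simp: quasi_decreasing_def)
    then show ?thesis using prim_nonneg[OF w, of t] that by (cases "prim w t = 0") auto
  qed
  obtain C1 where C1: "\<And>s t. 0 < s \<Longrightarrow> s < t \<Longrightarrow> prim w t powr (1 / p) / t powr \<delta> \<le> C1 * (prim w s powr (1 / p) / s powr \<delta>)"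
    using qd by (auto simp: quasi_decreasing_def)
  have C1p: "0 < C1"
  proof -
    have "0 < prim w 2 powr (1 / p) / 2 powr \<delta>" using pos[of 2] by simp
    also have "\<dots> \<le> C1 * (prim w 1 powr (1 / p) / 1 powr \<delta>)" by (rule C1) auto
    finally show ?thesis using pos[of 1] by (simp add: zero_less_mult_iff)
  qed
  define D where "D = (2 powr \<delta> * C1) powr p"
  have D: "0 < D" using C1p by (simp add: D_def)
  have doubling: "prim w (2 * x) \<le> D * prim w x" if x: "0 < x" for x
  proof -
    have "prim w (2 * x) powr (1 / p) \<le> 2 powr \<delta> * C1 * prim w x powr (1 / p)"
      using C1[of x "2 * x"] x by (simp add: powr_mult field_simps)
    then have "(prim w (2 * x) powr (1 / p)) powr p \<le> (2 powr \<delta> * C1 * prim w x powr (1 / p)) powr p"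
      using p by (intro powr_mono2) auto
    also have "\<dots> = D * (prim w x powr (1 / p)) powr p"
      unfolding D_def by (rule powr_mult)
    finally show ?thesis using p prim_nonneg[OF w] by (simp add: powr_powr)
  qed
  define p' where "p' = conj_exp p"
  have p': "0 < p'" "1 / p' = 1 - 1 / p" using p by (auto simp: p'_def conj_exp_def diff_divide_distrib)
  show ?thesis
    unfolding quasi_increasing_def
  proof (intro conjI exI allI impI)
    fix t :: real assume "0 < t"
    then show "0 < prim w t powr (1 / p) / t powr (1 - \<mu>)" using pos[of t] by simp
  next
    fix s x :: real assume sx: "0 < s \<and> s < x"
    then have x: "0 < x" by simp
    obtain n where n: "2 * prim w x < prim w (real (Suc n))" using prim_unbounded[OF w inf] by blast
    obtain k0 where "real (Suc n) / x < 2 ^ k0" using real_arch_pow[of 2 "real (Suc n) / x"] by auto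
    then have "real (Suc n) \<le> 2 ^ k0 * x" using x by (simp add: pos_divide_less_eq)
    then have k0: "2 * prim w x \<le> prim w (2 ^ k0 * x)"
      using prim_mono[OF w, of "real (Suc n)" "2 ^ k0 * x"] n by simp
    define k where "k = (LEAST k. 2 * prim w x \<le> prim w (2 ^ k * x))"
    have k: "2 * prim w x \<le> prim w (2 ^ k * x)" unfolding k_def by (rule LeastI[of "\<lambda>k. 2 * prim w x \<le> prim w (2 ^ k * x)", OF k0])
    \<comment> \<open>W(x) > 0 excludes k = 0, so there is a preceding dyadic point, where W is
      still below 2 W(x).\<close>
    have "k \<noteq> 0" using k pos[OF x] by (auto intro: ccontr)
    then obtain j where j: "k = Suc j" by (cases k) auto
    have "\<not> 2 * prim w x \<le> prim w (2 ^ j * x)"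
      using not_less_Least[of j "\<lambda>k. 2 * prim w x \<le> prim w (2 ^ k * x)"] j unfolding k_def[symmetric] by simp
    then have jW: "prim w (2 ^ j * x) \<le> 2 * prim w x" by simp
    define y where "y = 2 ^ k * x"
    have y: "x \<le> y" using x by (simp add: y_def)
    have "prim w y \<le> D * prim w (2 ^ j * x)" using doubling[of "2 ^ j * x"] x by (simp add: y_def j mult.assoc)
    also have "\<dots> \<le> D * (2 * prim w x)" using D jW by (intro mult_left_mono) auto
    finally have yD: "prim w y \<le> 2 * D * prim w x" by simp
    define c where "c = x powr (1 - \<mu>) / (2 * D * prim w x)"
    have c: "0 < c" using x D pos[OF x] by (simp add: c_def)
    have "ennreal (c powr p' * prim w x) \<le> ennreal (c powr p') * ennreal (prim w y - prim w x)"
      using k pos[OF x] by (simp add: ennreal_mult[symmetric] y_def ennreal_leI mult_left_mono)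
    also have "ennreal (prim w y - prim w x) = emeasure (half_line_measure w) {x..<y}"
      using emeasure_half_line_diff[OF w x y] by simp
    also have "ennreal (c powr p') * \<dots> = (\<integral>\<^sup>+t. ennreal (c powr p') * (ennreal (indicator {0<..} t * w t) * indicator {x..<y} t) \<partial>lebesgue)"
      using half_line_weight_measurable[OF w] unfolding half_line_measure_def
      by (subst emeasure_density) (auto simp: nn_integral_cmult)
    also have "\<dots> \<le> (\<integral>\<^sup>+t\<in>{s<..}. ennreal ((t powr (1 - \<mu>) / prim w t) powr p' * w t) \<partial>lebesgue)"
    proof (rule nn_integral_mono)
      fix t
      show "ennreal (c powr p') * (ennreal (indicator {0<..} t * w t) * indicator {x..<y} t)
        \<le> ennreal ((t powr (1 - \<mu>) / prim w t) powr p' * w t) * indicator {s<..} t"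
      proof (cases "t \<in> {x..<y}")
        case True
        then have t: "0 < t" "x \<le> t" "t \<le> y" "s < t" using sx by auto
        have w0: "0 \<le> w t" using w t by (simp add: half_line_weight_def)
        have "c \<le> t powr (1 - \<mu>) / prim w t"
          unfolding c_def using x \<mu> t pos[OF t(1)] order_trans[OF prim_mono[OF w t(1,3)] yD]
          by (intro frac_le powr_mono2) auto
        then have "c powr p' * w t \<le> (t powr (1 - \<mu>) / prim w t) powr p' * w t"
          using c p' w0 by (intro mult_right_mono powr_mono2) auto
        then show ?thesis using True t w0 by (simp add: ennreal_mult[symmetric] ennreal_leI)
      qed simp
    qed
    finally have "ennreal (c powr p' * prim w x) epowr (1 / p')
        \<le> (\<integral>\<^sup>+t\<in>{s<..}. ennreal ((t powr (1 - \<mu>) / prim w t) powr p' * w t) \<partial>lebesgue) epowr (1 / p')"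
      using p'(1) by (intro epowr_mono) auto
    also have "\<dots> \<le> ennreal (C * (s powr (1 - \<mu>) / prim w s powr (1 / p)))"
      unfolding p'_def using cond sx by simp
    finally have le: "ennreal ((c powr p' * prim w x) powr (1 / p')) \<le> ennreal (C * (s powr (1 - \<mu>) / prim w s powr (1 / p)))"
      using pos[OF x] by (simp add: epowr_ennreal)
    have "(c powr p' * prim w x) powr (1 / p') = c * (prim w x powr (1 - 1 / p))"
      unfolding p'(2)[symmetric] using c p'(1) by (simp add: powr_mult powr_powr)
    also have "\<dots> = x powr (1 - \<mu>) / (2 * D * prim w x powr (1 / p))"
      using pos[OF x] by (simp add: c_def powr_diff)
    finally have eq: "(c powr p' * prim w x) powr (1 / p') = x powr (1 - \<mu>) / (2 * D * prim w x powr (1 / p))" .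
    \<comment> \<open>The sign of C is not prescribed. A positive left side excludes the case in
      which \<open>ennreal\<close> truncates the right side to 0.\<close>
    have "0 < x powr (1 - \<mu>) / (2 * D * prim w x powr (1 / p))"
      using x D pos[OF x] by simp
    then have "x powr (1 - \<mu>) / (2 * D * prim w x powr (1 / p)) \<le> C * (s powr (1 - \<mu>) / prim w s powr (1 / p))"
      using le unfolding eq ennreal_le_iff2 by linarith
    then have "x powr (1 - \<mu>) * prim w s powr (1 / p) \<le> 2 * D * C * (s powr (1 - \<mu>) * prim w x powr (1 / p))"
      using x sx D pos[of x] pos[of s] by (simp add: field_simps)
    then show "prim w s powr (1 / p) / s powr (1 - \<mu>) \<le> 2 * D * C * (prim w x powr (1 / p) / x powr (1 - \<mu>))"
      using x sx by (simp add: field_simps)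
  qed
qed

section \<open>Lorentz spaces\<close>

lemma rearr_antimono:
  assumes "s \<le> t"
  shows "rearr f t \<le> rearr f s"
  unfolding rearr_def by (intro Inf_superset_mono) (use order_trans[OF _ ennreal_leI[OF assms]] in blast)

lemma rearr_le:
  assumes "0 \<le> y" "emeasure lebesgue {x. y < norm (f x)} \<le> ennreal t"
  shows "rearr f t \<le> ennreal y"
  unfolding rearr_def by (intro Inf_lower) (use assms in auto)

text \<open>Strictness supplies an admissible level below y whether or not the infimum is attained.
  For this reason the norm is later taken strictly below N.\<close>

lemma rearr_less_imp:
  fixes f :: "'a::euclidean_space \<Rightarrow> 'k::real_normed_field"
  assumes f: "f \<in> borel_measurable lebesgue" and less: "rearr f t < ennreal y"
  shows "emeasure lebesgue {x. y < norm (f x)} \<le> ennreal t"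
proof -
  obtain z where z: "0 \<le> z" "emeasure lebesgue {x. norm (f x) > z} \<le> ennreal t" "ennreal z < ennreal y"
    using less by (auto simp: rearr_def Inf_less_iff)
  have "z < y" using z by (simp add: ennreal_less_iff)
  moreover have "{x. z < norm (f x)} \<in> sets lebesgue"
    using f by (intro sets_lebesgue_greater) measurable
  ultimately have "emeasure lebesgue {x. y < norm (f x)} \<le> emeasure lebesgue {x. z < norm (f x)}"
    by (intro emeasure_mono) auto
  then show ?thesis using z by simp
qed

text \<open>On (0,s) the rearrangement is at least its value at s, so this part of the integral
  alone is at least that value to the power p times W(s).\<close>

lemma weak_Lorentz_norm_le_Lorentz_norm:
  assumes w: "half_line_weight w" and p: "0 < p"
  shows "weak_Lorentz_norm p w f \<le> Lorentz_norm p w f"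
  unfolding weak_Lorentz_norm_def
proof (rule SUP_least)
  fix s :: real assume "s \<in> {0<..}"
  then have s: "0 < s" by simp
  have "(rearr f s epowr p) * ennreal (prim w s)
      = (\<integral>\<^sup>+t. (rearr f s epowr p) * (ennreal (indicator {0<..} t * w t) * indicator {0<..<s} t) \<partial>lebesgue)"
    using half_line_weight_measurable[OF w] unfolding emeasure_half_line_prim[OF w s, symmetric] half_line_measure_def
    by (subst emeasure_density) (auto simp: nn_integral_cmult)
  also have "\<dots> \<le> (\<integral>\<^sup>+t\<in>{0<..}. (rearr f t epowr p * ennreal (w t)) \<partial>lebesgue)"
  proof (rule nn_integral_mono)
    fix t
    show "(rearr f s epowr p) * (ennreal (indicator {0<..} t * w t) * indicator {0<..<s} t)
      \<le> rearr f t epowr p * ennreal (w t) * indicator {0<..} t"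
    proof (cases "t \<in> {0<..<s}")
      case True
      then have "rearr f s epowr p \<le> rearr f t epowr p"
        using p by (intro epowr_mono rearr_antimono) auto
      then show ?thesis using True by (auto intro!: mult_right_mono)
    qed simp
  qed
  finally have le: "((rearr f s epowr p) * ennreal (prim w s)) epowr (1 / p) \<le> Lorentz_norm p w f"
    unfolding Lorentz_norm_def using p by (intro epowr_mono) auto
  have "rearr f s * ennreal (prim w s powr (1 / p)) = ((rearr f s epowr p) * ennreal (prim w s)) epowr (1 / p)"
  \<comment> \<open>In the infinite case both sides are 0 if W(s) = 0, since infinity times 0 is 0,
    and both are infinite otherwise.\<close>
  proof (cases "rearr f s = \<infinity>")
    case True
    then show ?thesis using prim_nonneg[OF w, of s]
      by (cases "prim w s = 0") (auto simp: epowr_def ennreal_top_mult)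
  next
    case False
    then obtain r where r: "rearr f s = ennreal r" "0 \<le> r" by (cases "rearr f s") auto
    show ?thesis using r p prim_nonneg[OF w, of s]
      by (simp add: epowr_ennreal ennreal_mult[symmetric] powr_mult powr_powr)
  qed
  then show "rearr f s * ennreal (prim w s powr (1 / p)) \<le> Lorentz_norm p w f"
    using le by simp
qed

text \<open>The exponents of \<open>extrapolation_distribution\<close> arise by inversion:
  (s/t)^delta = 1/l at s = t l^(-1/delta), and (s/t)^(1-mu) = 1/l at s = t l^(-1/(1-mu)).
  Quasi-decrease is used for s <= t, that is l >= 1, and quasi-increase for s >= t.\<close>

theorem bounded_op_Lorentz:
  fixes T :: "('a::euclidean_space \<Rightarrow> 'k::real_normed_field) \<Rightarrow> ('a \<Rightarrow> 'k)"
  assumes p0: "1 \<le> p0" and lb: "locally_bounded \<phi>"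
    and T: "\<And>u. u \<in> Ap p0 \<Longrightarrow> bounded_op T (Lp_norm p0 u) (weak_Lp_norm p0 u) (\<phi> (enn2real (Ap_const p0 u)))"
    and w: "half_line_weight w" and p: "0 < p"
    and \<delta>: "0 < \<delta>" "\<delta> < 1" and qd: "quasi_decreasing (\<lambda>t. prim w t powr (1 / p) / t powr \<delta>)"
    and \<mu>: "0 < \<mu>" "\<mu> < 1" and qi: "quasi_increasing (\<lambda>t. prim w t powr (1 / p) / t powr (1 - \<mu>))"
  shows "\<exists>C. bounded_op T (Lorentz_norm p w) (weak_Lorentz_norm p w) C"
proof -
  define h where "h t = prim w t powr (1 / p)" for t
  have h: "0 < h t" if t: "0 < t" for t
  proof -
    have "0 < h t / t powr \<delta>" using qd t by (simp add: quasi_decreasing_def h_def)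
    then show ?thesis using t by (simp add: zero_less_divide_iff)
  qed
  obtain C1 where C1: "\<And>s t. 0 < s \<Longrightarrow> s < t \<Longrightarrow> h t / t powr \<delta> \<le> C1 * (h s / s powr \<delta>)"
    using qd by (auto simp: quasi_decreasing_def h_def)
  obtain C2 where C2: "\<And>s t. 0 < s \<Longrightarrow> s < t \<Longrightarrow> h s / s powr (1 - \<mu>) \<le> C2 * (h t / t powr (1 - \<mu>))"
    using qi by (auto simp: quasi_increasing_def h_def)
  \<comment> \<open>The 1 covers s = t, which the definitions of quasi-monotonicity leave
    out.\<close>
  define A where "A = max 1 (max C1 C2)"
  have A: "1 \<le> A" by (simp add: A_def)
  have dec: "h t * (s / t) powr \<delta> \<le> A * h s" if "0 < s" "s \<le> t" for s t
  proof (cases "s = t")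
    case True
    then show ?thesis using A h[of s] that by simp
  next
    case False
    then have "h t / t powr \<delta> \<le> C1 * (h s / s powr \<delta>)" using that by (intro C1) auto
    also have "\<dots> \<le> A * (h s / s powr \<delta>)"
      using h[of s] that by (intro mult_right_mono) (auto simp: A_def)
    finally show ?thesis using that by (simp add: powr_divide field_simps)
  qed
  have inc: "h t * (s / t) powr (1 - \<mu>) \<le> A * h s" if "0 < t" "t \<le> s" for s t
  proof (cases "s = t")
    case True
    then show ?thesis using A h[of s] that by simp
  next
    case False
    then have "h t / t powr (1 - \<mu>) \<le> C2 * (h s / s powr (1 - \<mu>))" using that by (intro C2) auto
    also have "\<dots> \<le> A * (h s / s powr (1 - \<mu>))"
      using h[of s] that by (intro mult_right_mono) (auto simp: A_def)
    finally show ?thesis using that by (simp add: powr_divide field_simps)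
  qed
  have ab: "1 < 1 / \<delta>" "1 < 1 / (1 - \<mu>)" using \<delta> \<mu> by auto
  obtain K where K: "0 < K" and dist:
    "\<And>f t B. \<lbrakk>f \<in> borel_measurable lebesgue; 0 < t; 0 < B;
       \<And>l. 1 \<le> l \<Longrightarrow> emeasure lebesgue {x. l * B < norm (f x)} \<le> ennreal (t * l powr - (1 / \<delta>));
       \<And>l. 0 < l \<Longrightarrow> l \<le> 1 \<Longrightarrow> emeasure lebesgue {x. l * B < norm (f x)} \<le> ennreal (t * l powr - (1 / (1 - \<mu>)))\<rbrakk>
      \<Longrightarrow> T f \<in> borel_measurable lebesgue \<and> emeasure lebesgue {x. K * B < norm (T f x)} \<le> ennreal t"
    by (rule extrapolation_distribution[OF p0 lb T ab]) blast+
  have main: "T f \<in> borel_measurable lebesgue \<and> rearr (T f) t * ennreal (h t) \<le> ennreal (K * A * N)"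
    if f: "f \<in> borel_measurable lebesgue" and fN: "Lorentz_norm p w f < ennreal N" and t: "0 < t" for f t N
  proof -
    have N: "0 < N" using le_less_trans[OF zero_le fN] by simp
    have fd: "emeasure lebesgue {x. N / h s < norm (f x)} \<le> ennreal s" if s: "0 < s" for s
    proof (rule rearr_less_imp[OF f])
      have "rearr f s * ennreal (h s) \<le> weak_Lorentz_norm p w f"
        unfolding weak_Lorentz_norm_def h_def using s by (intro SUP_upper) simp
      also have "\<dots> < ennreal N"
        using weak_Lorentz_norm_le_Lorentz_norm[OF w p] fN by (rule le_less_trans)
      finally have "rearr f s * ennreal (h s) < ennreal (N / h s) * ennreal (h s)"
        using h[OF s] N by (simp add: ennreal_mult[symmetric])
      then show "rearr f s < ennreal (N / h s)"
        by (meson mult_right_mono not_less zero_le)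
    qed
    define B where "B = A * N / h t"
    have B: "0 < B" using A N h[OF t] by (simp add: B_def)
    \<comment> \<open>The condition on s and l says N / h(s) <= l B, so \<open>fd\<close> at s
      applies to the level l B.\<close>
    have lev: "emeasure lebesgue {x. l * B < norm (f x)} \<le> ennreal s"
      if s: "0 < s" and l: "0 < l" and le: "h t \<le> A * l * h s" for s l
    proof -
      have "N * h t \<le> N * (A * l * h s)" using N le by (intro mult_left_mono) auto
      then have "N / h s \<le> l * B" using h[OF s] h[OF t] by (simp add: B_def field_simps)
      moreover have "{x. N / h s < norm (f x)} \<in> sets lebesgue"
        using f by (intro sets_lebesgue_greater) measurable
      ultimately have "emeasure lebesgue {x. l * B < norm (f x)} \<le> emeasure lebesgue {x. N / h s < norm (f x)}"
        by (intro emeasure_mono) auto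
      then show ?thesis using fd[OF s] by simp
    qed
    have *: "T f \<in> borel_measurable lebesgue \<and> emeasure lebesgue {x. K * B < norm (T f x)} \<le> ennreal t"
    proof (rule dist[OF f t B])
      fix l :: real assume l: "1 \<le> l"
      define s where "s = t * l powr - (1 / \<delta>)"
      have "l powr - (1 / \<delta>) \<le> l powr 0" using l \<delta> by (intro powr_mono) auto
      then have s: "0 < s" "s \<le> t" using t l by (auto simp: s_def mult_left_le)
      have "(s / t) powr \<delta> = l powr - 1" using t \<delta> by (simp add: s_def powr_powr)
      then have e: "(s / t) powr \<delta> = 1 / l" using l by (simp add: powr_minus_divide)
      have "h t \<le> A * l * h s" using dec[OF s] l unfolding e by (simp add: field_simps)
      then show "emeasure lebesgue {x. l * B < norm (f x)} \<le> ennreal (t * l powr - (1 / \<delta>))"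
        using lev[OF s(1), of l] l by (simp add: s_def)
    next
      fix l :: real assume l: "0 < l" "l \<le> 1"
      define s where "s = t * l powr - (1 / (1 - \<mu>))"
      have "1 powr - (1 / (1 - \<mu>)) \<le> l powr - (1 / (1 - \<mu>))" using l \<mu> by (intro powr_mono2') auto
      then have s: "0 < s" "t \<le> s" using t l by (auto simp: s_def)
      have "(s / t) powr (1 - \<mu>) = l powr - 1" using t \<mu> by (simp add: s_def powr_powr)
      then have e: "(s / t) powr (1 - \<mu>) = 1 / l" using l by (simp add: powr_minus_divide)
      have "h t \<le> A * l * h s" using inc[OF t s(2)] l unfolding e by (simp add: field_simps)
      then show "emeasure lebesgue {x. l * B < norm (f x)} \<le> ennreal (t * l powr - (1 / (1 - \<mu>)))"
        using lev[OF s(1), of l] l by (simp add: s_def)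
    qed
    then have "rearr (T f) t \<le> ennreal (K * B)"
      using K B by (intro rearr_le) auto
    then have "rearr (T f) t * ennreal (h t) \<le> ennreal (K * B) * ennreal (h t)"
      by (rule mult_right_mono) simp
    also have "\<dots> = ennreal (K * B * h t)"
      using K B h[OF t] by (subst ennreal_mult[symmetric]) auto
    also have "K * B * h t = K * A * N"
      using h[OF t] by (simp add: B_def)
    finally show ?thesis using * by simp
  qed
  have "bounded_op T (Lorentz_norm p w) (weak_Lorentz_norm p w) (K * A)"
    unfolding bounded_op_def
  proof (intro ballI impI conjI)
    fix f :: "'a \<Rightarrow> 'k" assume f: "f \<in> borel_measurable lebesgue" and fin: "Lorentz_norm p w f < \<infinity>"
    then obtain N where N: "Lorentz_norm p w f = ennreal N" "0 \<le> N" by (cases "Lorentz_norm p w f") auto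
    show "T f \<in> borel_measurable lebesgue"
      using main[OF f, of "N + 1" 1] N by (simp add: ennreal_less_iff del: ennreal_plus)
    show "weak_Lorentz_norm p w (T f) \<le> ennreal (K * A) * Lorentz_norm p w f"
      unfolding weak_Lorentz_norm_def
    proof (rule SUP_least)
      fix t :: real assume "t \<in> {0<..}"
      then have t: "0 < t" by simp
      have "rearr (T f) t * ennreal (h t) \<le> ennreal (K * A * N)"
      \<comment> \<open>\<open>main\<close> takes a number strictly above the norm; an excess of e /
        (K A) costs e in the conclusion.\<close>
      proof (rule ennreal_le_epsilon)
        fix e :: real assume e: "0 < e"
        have "Lorentz_norm p w f < ennreal (N + e / (K * A))"
          using N e K A by (simp add: ennreal_less_iff del: ennreal_plus)
        from main[OF f this t] have "rearr (T f) t * ennreal (h t) \<le> ennreal (K * A * (N + e / (K * A)))" by simp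
        also have "K * A * (N + e / (K * A)) = K * A * N + e" using K A by (simp add: distrib_left)
        finally show "rearr (T f) t * ennreal (h t) \<le> ennreal (K * A * N) + ennreal e"
          using K A N e by simp
      qed
      then show "rearr (T f) t * ennreal (prim w t powr (1 / p)) \<le> ennreal (K * A) * Lorentz_norm p w f"
        using K A N by (simp add: h_def ennreal_mult)
    qed
  qed
  then show ?thesis by blast
qed

theorem theorem3p23:
  fixes T :: "('a::euclidean_space \<Rightarrow> 'k::real_normed_field) \<Rightarrow> ('a \<Rightarrow> 'k)"
    and p0 p :: real and \<phi> w :: "real \<Rightarrow> real"
  assumes "1 \<le> p0"
    and "locally_bounded \<phi>"
    and "\<forall>u \<in> Ap p0. bounded_op T (Lp_norm p0 u) (weak_Lp_norm p0 u) (\<phi> (enn2real (Ap_const p0 u)))"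
    and "half_line_weight w"
    and "cond_a p w \<or> cond_b p w"
  shows "\<exists>C. bounded_op T (Lorentz_norm p w) (weak_Lorentz_norm p w) C"
proof -
  obtain \<delta> \<mu> where "0 < p" "0 < \<delta>" "\<delta> < 1" "0 < \<mu>" "\<mu> < 1"
    "quasi_decreasing (\<lambda>t. prim w t powr (1 / p) / t powr \<delta>)"
    "quasi_increasing (\<lambda>t. prim w t powr (1 / p) / t powr (1 - \<mu>))"
    using assms(5)
  proof
    assume a: "cond_a p w"
    then have p: "1 < p" and Bp: "w \<in> Bp p" and inf: "(\<integral>\<^sup>+t\<in>{0<..}. ennreal (w t) \<partial>lebesgue) = \<infinity>"
      by (auto simp: cond_a_def)
    obtain \<mu> C where \<mu>: "0 < \<mu>" "\<mu> < 1" and C: "\<And>s. 0 < s \<Longrightarrow>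
      (\<integral>\<^sup>+t\<in>{s<..}. ennreal ((t powr (1 - \<mu>) / prim w t) powr conj_exp p * w t) \<partial>lebesgue) epowr (1 / conj_exp p)
        \<le> ennreal (C * (s powr (1 - \<mu>) / prim w s powr (1 / p)))"
      using a by (auto simp: cond_a_def)
    obtain \<delta> where \<delta>: "0 < \<delta>" "\<delta> < 1" "quasi_decreasing (\<lambda>t. prim w t powr (1 / p) / t powr \<delta>)"
      using Bp_quasi_decreasing[OF assms(4) _ Bp inf] p by auto
    show thesis
      using that[OF _ \<delta>(1,2) \<mu> \<delta>(3) integral_condition_quasi_increasing[OF assms(4) p \<mu> \<delta>(3) inf C]] p by simp
  next
    assume "cond_b p w"
    then show thesis using that by (auto simp: cond_b_def)
  qed
  then show ?thesis
    using assms by (intro bounded_op_Lorentz[of p0 \<phi> T w p \<delta> \<mu>]) auto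
qed

end
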